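(* Let $a,b,n,s$ be positive integers with $s\ge n+1$ and $b(s-n)+1\le a\le sb$. Let $\mathcal{F}=\{f_1,\dots,f_s\}$ be a generic set of forms sharing a common degree $d$ in $R=\mathbb{K}[x_0,\dots,x_n]$. Then the following statements are equivalent: (a) $I_a(\mathcal{F}^b)^m\nsubseteq\langle f_1,\dots,f_s\rangle\, I_a(\mathcal{F}^b)^{(m)_*}$ for all positive integers $m$; (b) $I_a(\mathcal{F}^b)^m\nsubseteq\langle f_1,\dots,f_s\rangle\, I_a(\mathcal{F}^b)^{(m)_*}$ for some positive integer $m$; (c) $a$ is a multiple of $b$.
   Context: $\mathbb{K}$ is an infinite field; $R$ is standard graded; a form is a homogeneous polynomial of positive degree. A set of forms in $R$ is generic if every subset of size at most $n+1$ forms an $R$-regular sequence. $I_a(\mathcal{F}^b)=\langle f_1^{n_1}\cdots f_s^{n_s}: 0\le n_i\le b,\ \sum_i n_i=a\rangle$. For an ideal $I$ of $R$ and $m\ge1$, the $m$-th $*$-symbolic power is $I^{(m)_*}=\bigcap_{\mathfrak{p}\in\operatorname{Min}(I)}(I^mR_{\mathfrak{p}}\cap R)$, where $\operatorname{Min}(I)$ is the set of minimal primes of $I$. *)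

theory Defs
  imports
    "HOL-Library.Poly_Mapping"
    "HOL-Computational_Algebra.Polynomial_Factorial"
    "HOL-Algebra.Ideal_Product"
    "HOL-Algebra.Subrings"
    "HOL-Algebra.Algebraic_Closure_Type"
begin

text \<open>
  A polynomial is a finitely supported map from exponent vectors to coefficients.
  The type itself has countably many variables; \<open>mpoly_ring n\<close> is the subring of those
  polynomials in which only the variables with index at most \<open>n\<close> occur.
\<close>

type_synonym 'k mpol = "(nat \<Rightarrow>\<^sub>0 nat) \<Rightarrow>\<^sub>0 'k"

definition mpoly_ring :: "nat \<Rightarrow> ('k::field) mpol ring" where
  "mpoly_ring n = ring_of_type_algebra\<lparr>carrier := {p. \<forall>t\<in>Poly_Mapping.keys p. Poly_Mapping.keys t \<subseteq> {..n}}\<rparr>"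

definition mon_deg :: "(nat \<Rightarrow>\<^sub>0 nat) \<Rightarrow> nat" where
  "mon_deg t = (\<Sum>i\<in>Poly_Mapping.keys t. Poly_Mapping.lookup t i)"

definition homogeneous :: "nat \<Rightarrow> ('k::zero) mpol \<Rightarrow> bool" where
  "homogeneous d p \<longleftrightarrow> (\<forall>t\<in>Poly_Mapping.keys p. mon_deg t = d)"

lemma cring_mpoly_ring: "cring (mpoly_ring n :: ('k::field) mpol ring)"
proof -
  let ?R = "ring_of_type_algebra :: 'k mpol ring"
  let ?A = "{p :: 'k mpol. \<forall>t\<in>Poly_Mapping.keys p. Poly_Mapping.keys t \<subseteq> {..n}}"
  interpret R: cring ?R
    by (rule cring_from_type_algebra)
  have minus: "\<ominus>\<^bsub>?R\<^esub> h = - h" for h :: "'k mpol"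
    using R.minus_equality[of "- h" h] by (simp add: ring_of_type_algebra_def)
  have "subcring ?A ?R"
  proof (rule R.subcringI'[OF R.subringI])
    show "?A \<subseteq> carrier ?R" by (simp add: ring_of_type_algebra_def)
    show "\<one>\<^bsub>?R\<^esub> \<in> ?A" by (simp add: ring_of_type_algebra_def)
    show "\<ominus>\<^bsub>?R\<^esub> h \<in> ?A" if "h \<in> ?A" for h
      using that by (simp add: minus)
    show "h1 \<otimes>\<^bsub>?R\<^esub> h2 \<in> ?A" if h: "h1 \<in> ?A" "h2 \<in> ?A" for h1 h2
    proof -
      have "Poly_Mapping.keys t \<subseteq> {..n}" if t: "t \<in> Poly_Mapping.keys (h1 * h2)" for t
      proof -
        obtain u v where "t = u + v" "u \<in> Poly_Mapping.keys h1" "v \<in> Poly_Mapping.keys h2"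
          using subsetD[OF keys_mult t] by blast
        then show ?thesis
          using h Poly_Mapping.keys_add[of u v] by blast
      qed
      then show ?thesis by (simp add: ring_of_type_algebra_def)
    qed
    show "h1 \<oplus>\<^bsub>?R\<^esub> h2 \<in> ?A" if "h1 \<in> ?A" "h2 \<in> ?A" for h1 h2
      using that Poly_Mapping.keys_add[of h1 h2] by (auto simp: ring_of_type_algebra_def)
  qed
  then show ?thesis
    unfolding mpoly_ring_def by (rule R.subcring_iff[THEN iffD1, rotated])
      (simp add: ring_of_type_algebra_def)
qed

definition regular_sequence :: "('a, 'b) ring_scheme \<Rightarrow> 'a list \<Rightarrow> bool" where
  "regular_sequence R fs \<longleftrightarrow>
     set fs \<subseteq> carrier R \<and>
     (\<forall>i<length fs. \<forall>r\<in>carrier R.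
        fs ! i \<otimes>\<^bsub>R\<^esub> r \<in> genideal R (set (take i fs)) \<longrightarrow> r \<in> genideal R (set (take i fs))) \<and>
     genideal R (set fs) \<noteq> carrier R"

text \<open>
  A finite set of forms is a regular sequence if its elements are, in some order without
  repetition; for forms of positive degree the order is irrelevant.
\<close>

definition generic_set :: "nat \<Rightarrow> ('k::field) mpol set \<Rightarrow> bool" where
  "generic_set n F \<longleftrightarrow>
     (\<forall>f\<in>F. f \<in> carrier (mpoly_ring n) \<and> (\<exists>d>0. homogeneous d f)) \<and>
     (\<forall>G\<subseteq>F. finite G \<and> card G \<le> n + 1 \<longrightarrow>
        (\<exists>fs. distinct fs \<and> set fs = G \<and> regular_sequence (mpoly_ring n) fs))"

definition fold_product_ideal :: "nat \<Rightarrow> nat \<Rightarrow> nat \<Rightarrow> ('k::field) mpol set \<Rightarrow> 'k mpol set" where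
  "fold_product_ideal n a b F =
     genideal (mpoly_ring n)
       {\<Prod>f\<in>F. f ^ N f | N. (\<forall>f\<in>F. N f \<le> b) \<and> (\<Sum>f\<in>F. N f) = a}"

definition minimal_primes :: "('a, 'b) ring_scheme \<Rightarrow> 'a set \<Rightarrow> 'a set set" where
  "minimal_primes R I =
     {p. primeideal p R \<and> I \<subseteq> p \<and> (\<forall>q. primeideal q R \<and> I \<subseteq> q \<and> q \<subseteq> p \<longrightarrow> q = p)}"

abbreviation ideal_power :: "('a, 'b) ring_scheme \<Rightarrow> 'a set \<Rightarrow> nat \<Rightarrow> 'a set" where
  "ideal_power R I m \<equiv> I [^]\<^bsub>ideals_set R\<^esub> m"

text \<open>
  The ring \<open>R = mpoly_ring n\<close> is a domain, so \<open>R\<^sub>p\<close> is realized as the subring of fractions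
  \<open>r/t\<close> with \<open>r \<in> R\<close>, \<open>t \<in> R - p\<close>, inside the fraction field of the ambient polynomial
  type; the canonical map from \<open>R\<close> to \<open>R\<^sub>p\<close> is \<^const>\<open>to_fract\<close>.
\<close>

definition localization :: "nat \<Rightarrow> ('k::field) mpol set \<Rightarrow> 'k mpol fract ring" where
  "localization n p = ring_of_type_algebra
     \<lparr>carrier := {Fract r t | r t. r \<in> carrier (mpoly_ring n) \<and> t \<in> carrier (mpoly_ring n) - p}\<rparr>"

lemma cring_localization:
  assumes "primeideal p (mpoly_ring n)"
  shows "cring (localization n p :: ('k::field) mpol fract ring)"
proof -
  let ?K = "ring_of_type_algebra :: 'k mpol fract ring"
  let ?P = "mpoly_ring n :: 'k mpol ring"
  let ?A = "{Fract r t | r t. r \<in> carrier ?P \<and> t \<in> carrier ?P - p}"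
  interpret p: primeideal p ?P by (rule assms)
  interpret K: cring ?K by (rule cring_from_type_algebra)
  have mult: "x \<otimes>\<^bsub>?P\<^esub> y = x * y" and add: "x \<oplus>\<^bsub>?P\<^esub> y = x + y"
    and one: "\<one>\<^bsub>?P\<^esub> = 1" and zero: "\<zero>\<^bsub>?P\<^esub> = 0" for x y
    by (simp_all add: mpoly_ring_def ring_of_type_algebra_def)
  have neg: "- x \<in> carrier ?P" if "x \<in> carrier ?P" for x
    using that by (simp add: mpoly_ring_def)
  have nz: "t \<noteq> 0" if "t \<in> carrier ?P - p" for t
    using that zero additive_subgroup.zero_closed[OF p.additive_subgroup_axioms] by auto
  have prod: "t * u \<in> carrier ?P - p" if "t \<in> carrier ?P - p" "u \<in> carrier ?P - p" for t u
    using that p.I_prime[of t u] p.m_closed[of t u] by (auto simp: mult)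
  have one': "1 \<in> carrier ?P - p"
    using p.one_closed p.one_imp_carrier p.I_notcarr by (auto simp: one)
  have minus: "\<ominus>\<^bsub>?K\<^esub> h = - h" for h :: "'k mpol fract"
    using K.minus_equality[of "- h" h] by (simp add: ring_of_type_algebra_def)
  have "subcring ?A ?K"
  proof (rule K.subcringI'[OF K.subringI])
    show "?A \<subseteq> carrier ?K" by (simp add: ring_of_type_algebra_def)
    show "\<one>\<^bsub>?K\<^esub> \<in> ?A"
      using one' by (auto simp: ring_of_type_algebra_def One_fract_def)
    show "\<ominus>\<^bsub>?K\<^esub> h \<in> ?A" if "h \<in> ?A" for h
      using that neg by (fastforce simp: minus)
    show "h1 \<otimes>\<^bsub>?K\<^esub> h2 \<in> ?A" if h: "h1 \<in> ?A" "h2 \<in> ?A" for h1 h2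
    proof -
      obtain r t r' t' where *: "h1 = Fract r t" "h2 = Fract r' t'" "r \<in> carrier ?P"
        "r' \<in> carrier ?P" "t \<in> carrier ?P - p" "t' \<in> carrier ?P - p"
        using h by blast
      have "h1 * h2 = Fract (r * r') (t * t')" by (simp add: *)
      moreover have "r * r' \<in> carrier ?P" using p.m_closed[of r r'] * by (simp add: mult)
      ultimately show ?thesis using prod[of t t'] * by (auto simp: ring_of_type_algebra_def)
    qed
    show "h1 \<oplus>\<^bsub>?K\<^esub> h2 \<in> ?A" if h: "h1 \<in> ?A" "h2 \<in> ?A" for h1 h2
    proof -
      obtain r t r' t' where *: "h1 = Fract r t" "h2 = Fract r' t'" "r \<in> carrier ?P"
        "r' \<in> carrier ?P" "t \<in> carrier ?P - p" "t' \<in> carrier ?P - p"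
        using h by blast
      have "h1 + h2 = Fract (r * t' + r' * t) (t * t')" using nz[OF *(5)] nz[OF *(6)] by (simp add: *)
      moreover have "r * t' + r' * t \<in> carrier ?P"
        using p.a_closed[of "r * t'" "r' * t"] p.m_closed[of r t'] p.m_closed[of r' t] *
        by (simp add: mult add)
      ultimately show ?thesis using prod[of t t'] * by (auto simp: ring_of_type_algebra_def)
    qed
  qed
  then show ?thesis
    unfolding localization_def by (rule K.subcring_iff[THEN iffD1, rotated])
      (simp add: ring_of_type_algebra_def)
qed

definition extension_localization ::
    "nat \<Rightarrow> ('k::field) mpol set \<Rightarrow> 'k mpol set \<Rightarrow> 'k mpol fract set" where
  "extension_localization n p J = genideal (localization n p) (to_fract ` J)"

definition star_symbolic_power ::
    "nat \<Rightarrow> ('k::field) mpol set \<Rightarrow> nat \<Rightarrow> 'k mpol set" where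
  "star_symbolic_power n I m =
     {r \<in> carrier (mpoly_ring n). \<forall>p\<in>minimal_primes (mpoly_ring n) I.
        to_fract r \<in> extension_localization n p (ideal_power (mpoly_ring n) I m)}"

end

theory Submission
  imports Defs
begin

text \<open>
  Put \<open>c = \<lfloor>(a - 1) / b\<rfloor>\<close>, \<open>h = s - c\<close> and \<open>e = a - b c\<close>, so that \<open>1 \<le> h \<le> n\<close>, \<open>1 \<le> e \<le> b\<close>, and \<open>b\<close> divides
  \<open>a\<close> iff \<open>e = b\<close>. A minimal prime \<open>p\<close> of \<open>I = I\<^sub>a(F\<^sup>b)\<close> contains exactly \<open>h\<close> of the forms, and \<open>I\<close> is
  generated locally at \<open>p\<close> by the \<open>e\<close>-fold products of these \<open>h\<close> forms.

  If \<open>e < b\<close>, every generator of \<open>I\<^sup>m\<close> is divisible by a form whose removal leaves total weight at least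
  \<open>e m\<close> on each \<open>h\<close>-subset, so the quotient lies in the symbolic power.

  If \<open>e = b\<close>, split \<open>F\<close> into \<open>W\<close> of size \<open>h - 1\<close> and \<open>U\<close> of size \<open>c + 1\<close>. For \<open>j \<in> U\<close> the \<open>m\<close>-th symbolic
  power lies in \<open>(W, j\<^sup>M)\<close>, where \<open>M = b m\<close>, because this ideal is unmixed; hence it lies in \<open>(W, g)\<close> with
  \<open>g = \<Prod>\<^sub>U j\<^sup>M \<in> I\<^sup>m\<close>. Then \<open>g \<in> (F) \<cdot> (W, g)\<close> would put \<open>1 - z\<close> into \<open>(W)\<close> for some \<open>z\<close> without constant
  term.

  Unmixedness is elementary here: \<open>W\<close> and \<open>j\<close> extend within \<open>F\<close> to a regular sequence of \<open>n + 1\<close> forms, the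
  remaining forms stay algebraically independent modulo a prime of zero divisors, and \<open>n + 2\<close> polynomials
  in \<open>n + 1\<close> variables are never algebraically independent, by counting monomials.
\<close>

section \<open>Ideals of a subring\<close>

text \<open>Ideals are taken in a subset \<open>P\<close> of a type-class ring, so that the ordinary
  \<open>+\<close>, \<open>*\<close> and the simplifier apply. The link with the record-based
  notions is made later, by \<open>ideal_iff_is_ideal\<close> and the lemmas after it.\<close>

locale subring_carrier =
  fixes P :: "'a::comm_ring_1 set"
  assumes zero_mem [simp]: "0 \<in> P"
    and one_mem [simp]: "1 \<in> P"
    and add_mem [simp]: "x \<in> P \<Longrightarrow> y \<in> P \<Longrightarrow> x + y \<in> P"
    and uminus_mem [simp]: "x \<in> P \<Longrightarrow> - x \<in> P"
    and mult_mem [simp]: "x \<in> P \<Longrightarrow> y \<in> P \<Longrightarrow> x * y \<in> P"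
begin

lemma diff_mem [simp]: "x \<in> P \<Longrightarrow> y \<in> P \<Longrightarrow> x - y \<in> P"
  using add_mem[of x "- y"] by simp

lemma power_mem [simp]: "x \<in> P \<Longrightarrow> x ^ k \<in> P"
  by (induction k) auto

lemma sum_mem: "(\<And>i. i \<in> A \<Longrightarrow> f i \<in> P) \<Longrightarrow> sum f A \<in> P"
  by (induction A rule: infinite_finite_induct) auto

lemma prod_mem: "(\<And>i. i \<in> A \<Longrightarrow> f i \<in> P) \<Longrightarrow> prod f A \<in> P"
  by (induction A rule: infinite_finite_induct) auto

definition is_ideal :: "'a set \<Rightarrow> bool" where
  "is_ideal J \<longleftrightarrow> J \<subseteq> P \<and> 0 \<in> J \<and> (\<forall>x\<in>J. \<forall>y\<in>J. x + y \<in> J) \<and> (\<forall>r\<in>P. \<forall>x\<in>J. r * x \<in> J)"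

definition is_prime :: "'a set \<Rightarrow> bool" where
  "is_prime p \<longleftrightarrow> is_ideal p \<and> 1 \<notin> p \<and> (\<forall>x\<in>P. \<forall>y\<in>P. x * y \<in> p \<longrightarrow> x \<in> p \<or> y \<in> p)"

definition minimal_over :: "'a set \<Rightarrow> 'a set \<Rightarrow> bool" where
  "minimal_over J p \<longleftrightarrow>
     is_prime p \<and> J \<subseteq> p \<and> (\<forall>q. is_prime q \<and> J \<subseteq> q \<and> q \<subseteq> p \<longrightarrow> q = p)"

text \<open>For an ideal \<open>J\<close> this is J + (x). Adding one generator at a time matches
  the recursion over a sequence, and \<open>adjoin_list {0} xs\<close> is the ideal generated by
  \<open>xs\<close> (see \<open>genideal_set\<close>).\<close>

definition adjoin :: "'a set \<Rightarrow> 'a \<Rightarrow> 'a set" where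
  "adjoin J x = {q + x * r | q r. q \<in> J \<and> r \<in> P}"

definition nonzerodiv :: "'a set \<Rightarrow> 'a \<Rightarrow> bool" where
  "nonzerodiv J x \<longleftrightarrow> (\<forall>r\<in>P. x * r \<in> J \<longrightarrow> r \<in> J)"

text \<open>The nonzerodivisor half of regularity. The base ideal is a parameter so that an
  induction over the list can pass to the quotient by its head.\<close>

primrec regseq :: "'a set \<Rightarrow> 'a list \<Rightarrow> bool" where
  "regseq J [] = True"
| "regseq J (x # xs) = (nonzerodiv J x \<and> regseq (adjoin J x) xs)"

abbreviation adjoin_list :: "'a set \<Rightarrow> 'a list \<Rightarrow> 'a set" where
  "adjoin_list \<equiv> foldl adjoin"

lemma is_idealD:
  assumes "is_ideal J"
  shows "J \<subseteq> P" "0 \<in> J" "x \<in> J \<Longrightarrow> y \<in> J \<Longrightarrow> x + y \<in> J" "r \<in> P \<Longrightarrow> x \<in> J \<Longrightarrow> r * x \<in> J"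
    "r \<in> P \<Longrightarrow> x \<in> J \<Longrightarrow> x * r \<in> J" "x \<in> J \<Longrightarrow> x \<in> P"
    "x \<in> J \<Longrightarrow> - x \<in> J" "x \<in> J \<Longrightarrow> y \<in> J \<Longrightarrow> x - y \<in> J"
proof -
  show *: "J \<subseteq> P" "0 \<in> J" "x \<in> J \<Longrightarrow> y \<in> J \<Longrightarrow> x + y \<in> J" for x y
    using assms by (auto simp: is_ideal_def)
  show **: "r \<in> P \<Longrightarrow> x \<in> J \<Longrightarrow> r * x \<in> J" for r x
    using assms by (auto simp: is_ideal_def)
  show "r \<in> P \<Longrightarrow> x \<in> J \<Longrightarrow> x * r \<in> J" using **[of r x] by (simp add: mult.commute)
  show "x \<in> J \<Longrightarrow> x \<in> P" using * by auto
  show n: "x \<in> J \<Longrightarrow> - x \<in> J" for x using **[of "-1" x] by simp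
  show "x \<in> J \<Longrightarrow> y \<in> J \<Longrightarrow> x - y \<in> J" using *(3)[of x "- y"] n[of y] by simp
qed

lemma is_ideal_zero: "is_ideal {0}"
  by (auto simp: is_ideal_def)

lemma is_ideal_cancel_left: "is_ideal J \<Longrightarrow> x \<in> J \<Longrightarrow> x + y \<in> J \<Longrightarrow> y \<in> J"
  using is_idealD(8)[of J "x + y" x] by simp

lemma is_ideal_adjoin:
  assumes J: "is_ideal J" and x: "x \<in> P"
  shows "is_ideal (adjoin J x)"
  unfolding is_ideal_def
proof (intro conjI ballI)
  show "adjoin J x \<subseteq> P" using is_idealD(6)[OF J] x by (auto simp: adjoin_def)
  have "0 = 0 + x * 0" by simp
  then show "0 \<in> adjoin J x" using is_idealD(2)[OF J] zero_mem unfolding adjoin_def by blast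
next
  fix u v assume "u \<in> adjoin J x" "v \<in> adjoin J x"
  then obtain q r q' r' where *: "u = q + x * r" "v = q' + x * r'" "q \<in> J" "q' \<in> J" "r \<in> P" "r' \<in> P"
    by (auto simp: adjoin_def)
  have "u + v = (q + q') + x * (r + r')" by (simp add: * algebra_simps)
  moreover have "(q + q') + x * (r + r') \<in> adjoin J x"
    using * is_idealD(3)[OF J] add_mem unfolding adjoin_def by blast
  ultimately show "u + v \<in> adjoin J x" by simp
next
  fix c u assume c: "c \<in> P" "u \<in> adjoin J x"
  then obtain q r where *: "u = q + x * r" "q \<in> J" "r \<in> P" by (auto simp: adjoin_def)
  have "c * u = c * q + x * (c * r)" by (simp add: * algebra_simps)
  moreover have "c * q + x * (c * r) \<in> adjoin J x"
    using * c is_idealD(4)[OF J] mult_mem unfolding adjoin_def by blast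
  ultimately show "c * u \<in> adjoin J x" by simp
qed

lemma adjoin_superset: "J \<subseteq> adjoin J x"
proof
  fix q assume "q \<in> J"
  moreover have "q = q + x * 0" by simp
  ultimately show "q \<in> adjoin J x" using zero_mem unfolding adjoin_def by blast
qed

lemma adjoin_mem: "0 \<in> J \<Longrightarrow> x \<in> adjoin J x"
proof -
  have "x = 0 + x * 1" by simp
  then show "0 \<in> J \<Longrightarrow> x \<in> adjoin J x" using one_mem unfolding adjoin_def by blast
qed

lemma adjoin_memI: "q \<in> J \<Longrightarrow> r \<in> P \<Longrightarrow> q + x * r \<in> adjoin J x"
  by (auto simp: adjoin_def)

lemma adjoin_least:
  assumes "is_ideal L" "J \<subseteq> L" "x \<in> L"
  shows "adjoin J x \<subseteq> L"
proof
  fix u assume "u \<in> adjoin J x"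
  then obtain q r where *: "u = q + x * r" "q \<in> J" "r \<in> P" by (auto simp: adjoin_def)
  then have "x * r \<in> L" using is_idealD(5)[OF assms(1)] assms(3) by blast
  then show "u \<in> L" using is_idealD(3)[OF assms(1)] assms(2) * by blast
qed

lemma adjoin_commute: "adjoin (adjoin J x) y = adjoin (adjoin J y) x"
proof -
  have "adjoin (adjoin J x) y \<subseteq> adjoin (adjoin J y) x" for x y
  proof
    fix u assume "u \<in> adjoin (adjoin J x) y"
    then obtain q r r' where *: "u = q + x * r + y * r'" "q \<in> J" "r \<in> P" "r' \<in> P"
      by (auto simp: adjoin_def)
    then have "u = (q + y * r') + x * r" by simp
    then show "u \<in> adjoin (adjoin J y) x" using * by (simp only: adjoin_memI)
  qed
  then show ?thesis by blast
qed

lemma is_ideal_adjoin_list: "is_ideal J \<Longrightarrow> set xs \<subseteq> P \<Longrightarrow> is_ideal (adjoin_list J xs)"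
  by (induction xs arbitrary: J) (auto intro: is_ideal_adjoin)

lemma adjoin_list_superset: "J \<subseteq> adjoin_list J xs"
proof (induction xs arbitrary: J)
  case (Cons x xs)
  then show ?case using adjoin_superset[of J x] by (metis foldl_Cons order_trans)
qed simp

lemma adjoin_list_mem:
  assumes "is_ideal J" "set xs \<subseteq> P" "x \<in> set xs"
  shows "x \<in> adjoin_list J xs"
  using assms
proof (induction xs arbitrary: J)
  case (Cons y xs)
  have J': "is_ideal (adjoin J y)" using Cons.prems by (auto intro: is_ideal_adjoin)
  have "y \<in> adjoin_list (adjoin J y) xs"
    using adjoin_mem[of J y] adjoin_list_superset[of "adjoin J y" xs] is_idealD(2)[OF Cons.prems(1)]
    by auto
  then show ?case using Cons J' by auto
qed simp

lemma adjoin_list_least: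
  assumes "is_ideal L" "J \<subseteq> L" "set xs \<subseteq> L"
  shows "adjoin_list J xs \<subseteq> L"
  using assms
proof (induction xs arbitrary: J)
  case (Cons x xs)
  then show ?case using Cons.IH[of "adjoin J x"] adjoin_least[of L J x] by simp
qed simp

lemma regseq_append: "regseq J (xs @ ys) \<longleftrightarrow> regseq J xs \<and> regseq (adjoin_list J xs) ys"
  by (induction xs arbitrary: J) auto

lemma nonzerodivD: "nonzerodiv J x \<Longrightarrow> r \<in> P \<Longrightarrow> x * r \<in> J \<Longrightarrow> r \<in> J"
  by (auto simp: nonzerodiv_def)

lemma nonzerodiv_one: "nonzerodiv J 1"
  by (auto simp: nonzerodiv_def)

lemma nonzerodiv_mult: "x \<in> P \<Longrightarrow> y \<in> P \<Longrightarrow> nonzerodiv J x \<Longrightarrow> nonzerodiv J y \<Longrightarrow> nonzerodiv J (x * y)"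
  unfolding nonzerodiv_def by (metis mult.assoc mult_mem)

lemma nonzerodiv_power: "x \<in> P \<Longrightarrow> nonzerodiv J x \<Longrightarrow> nonzerodiv J (x ^ k)"
proof (induction k)
  case (Suc k)
  then show ?case using nonzerodiv_mult[of x "x ^ k" J] by simp
qed (simp add: nonzerodiv_one)

lemma nonzerodiv_prod:
  "(\<And>i. i \<in> A \<Longrightarrow> f i \<in> P \<and> nonzerodiv J (f i)) \<Longrightarrow> nonzerodiv J (prod f A)"
proof (induction A rule: infinite_finite_induct)
  case (insert i A)
  then show ?case using nonzerodiv_mult[of "f i" "prod f A" J] by (simp add: prod_mem)
qed (simp_all add: nonzerodiv_one)

section \<open>Prime ideals and minimal primes\<close>

lemma is_primeD:
  assumes "is_prime p"
  shows "is_ideal p" "1 \<notin> p" "x \<in> P \<Longrightarrow> y \<in> P \<Longrightarrow> x * y \<in> p \<Longrightarrow> x \<in> p \<or> y \<in> p"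
  using assms by (auto simp: is_prime_def)

lemma is_prime_nonzerodiv: "is_prime p \<Longrightarrow> x \<in> P \<Longrightarrow> x \<notin> p \<Longrightarrow> nonzerodiv p x"
  by (auto simp: is_prime_def nonzerodiv_def)

lemma is_prime_power:
  assumes "is_prime p" "x \<in> P" "x ^ k \<in> p"
  shows "x \<in> p"
  using assms(3)
proof (induction k)
  case 0
  then show ?case using is_primeD(2)[OF assms(1)] by simp
next
  case (Suc k)
  then show ?case using is_primeD(3)[OF assms(1,2), of "x ^ k"] assms(2) by auto
qed

lemma is_prime_prod:
  assumes "is_prime p" "finite A" "\<And>i. i \<in> A \<Longrightarrow> f i \<in> P" "prod f A \<in> p"
  shows "\<exists>i\<in>A. f i \<in> p"
  using assms(2-4)
proof (induction A)
  case empty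
  then show ?case using is_primeD(2)[OF assms(1)] by simp
next
  case (insert i A)
  then have "f i \<in> p \<or> prod f A \<in> p"
    using is_primeD(3)[OF assms(1), of "f i" "prod f A"] by (auto intro: prod_mem)
  then show ?case using insert by auto
qed

lemma is_ideal_prod_mem:
  assumes "is_ideal J" "finite A" "\<And>i. i \<in> A \<Longrightarrow> f i \<in> P" "i \<in> A" "f i \<in> J"
  shows "prod f A \<in> J"
proof -
  have "prod f A = f i * prod f (A - {i})" using assms(2,4) by (simp add: prod.remove)
  moreover have "prod f (A - {i}) \<in> P" using assms(3) by (auto intro: prod_mem)
  ultimately show ?thesis using is_idealD(5)[OF assms(1)] assms(5) by simp
qed

text \<open>Krull's argument: an ideal \<open>M\<close> maximal among those containing
  \<open>J\<close> and missing \<open>S\<close> is prime. If x and y lie outside \<open>M\<close>,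
  then M + (x) and M + (y) both meet \<open>S\<close>; the product of the two elements found lies in
  \<open>S\<close> and in M + (xy), so xy cannot lie in \<open>M\<close>.\<close>

lemma exists_prime_disjoint:
  assumes J: "is_ideal J" and S: "S \<subseteq> P" "1 \<in> S" "\<And>x y. x \<in> S \<Longrightarrow> y \<in> S \<Longrightarrow> x * y \<in> S"
    and disj: "J \<inter> S = {}"
  obtains p where "is_prime p" "J \<subseteq> p" "p \<inter> S = {}"
proof -
  define \<A> where "\<A> = {I. is_ideal I \<and> J \<subseteq> I \<and> I \<inter> S = {}}"
  have "\<exists>M\<in>\<A>. \<forall>Y\<in>\<A>. M \<subseteq> Y \<longrightarrow> Y = M"
  proof (rule subset_Zorn_nonempty)
    show "\<A> \<noteq> {}" using J disj by (auto simp: \<A>_def)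
    fix C assume ne: "C \<noteq> {}" and ch: "subset.chain \<A> C"
    then have CA: "C \<subseteq> \<A>" and lin: "\<And>Y Z. Y \<in> C \<Longrightarrow> Z \<in> C \<Longrightarrow> Y \<subseteq> Z \<or> Z \<subseteq> Y"
      by (auto simp: subset_chain_def)
    have CI: "is_ideal Y" if "Y \<in> C" for Y using CA that by (auto simp: \<A>_def)
    have "is_ideal (\<Union>C)"
      unfolding is_ideal_def
    proof (intro conjI ballI)
      show "\<Union>C \<subseteq> P" using CI is_idealD(1) by blast
      show "0 \<in> \<Union>C" using CI ne is_idealD(2) by blast
    next
      fix x y assume "x \<in> \<Union>C" "y \<in> \<Union>C"
      then obtain Y Z where "Y \<in> C" "Z \<in> C" "x \<in> Y" "y \<in> Z" by blast
      then obtain V where "V \<in> C" "x \<in> V" "y \<in> V" using lin by blast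
      then show "x + y \<in> \<Union>C" using CI is_idealD(3) by blast
    next
      fix r x assume "r \<in> P" "x \<in> \<Union>C"
      then show "r * x \<in> \<Union>C" using CI is_idealD(4) by blast
    qed
    then show "\<Union>C \<in> \<A>" using CA ne by (auto simp: \<A>_def)
  qed
  then obtain M where "M \<in> \<A>" and *: "\<forall>Y\<in>\<A>. M \<subseteq> Y \<longrightarrow> Y = M" ..
  then have M: "is_ideal M" "J \<subseteq> M" "M \<inter> S = {}" by (simp_all add: \<A>_def)
  have max: "Y = M" if "is_ideal Y" "J \<subseteq> Y" "Y \<inter> S = {}" "M \<subseteq> Y" for Y
    using * that by (simp add: \<A>_def)
  have big: "\<exists>q r. q \<in> M \<and> r \<in> P \<and> q + x * r \<in> S" if "x \<in> P" "x \<notin> M" for x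
  proof -
    have "adjoin M x \<noteq> M" using adjoin_mem[of M x] is_idealD(2)[OF M(1)] that by auto
    then have "adjoin M x \<inter> S \<noteq> {}"
      using max[OF is_ideal_adjoin[OF M(1) that(1)]] M(2) adjoin_superset[of M x] by blast
    then show ?thesis by (auto simp: adjoin_def)
  qed
  have "is_prime M"
    unfolding is_prime_def
  proof (intro conjI ballI impI)
    show "is_ideal M" by fact
    show "1 \<notin> M" using M(3) S(2) by auto
    fix x y assume xy: "x \<in> P" "y \<in> P" "x * y \<in> M"
    show "x \<in> M \<or> y \<in> M"
    proof (rule ccontr)
      assume "\<not> ?thesis"
      then obtain q r q' r' where *: "q \<in> M" "r \<in> P" "q + x * r \<in> S" "q' \<in> M" "r' \<in> P" "q' + y * r' \<in> S"
        using big xy by blast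
      have "(q + x * r) * (q' + y * r') = (q' + y * r') * q + (x * r) * q' + (r * r') * (x * y)"
        by (simp add: algebra_simps)
      also have "\<dots> \<in> M"
      proof (intro is_idealD(3)[OF M(1)])
        show "(q' + y * r') * q \<in> M" using * S(1) by (blast intro: is_idealD(4)[OF M(1)])
        show "(x * r) * q' \<in> M" using * xy is_idealD(4)[OF M(1), of "x * r" q'] by simp
        show "(r * r') * (x * y) \<in> M" using * xy is_idealD(4)[OF M(1), of "r * r'" "x * y"] by simp
      qed
      finally show False using S(3)[OF *(3,6)] M(3) by blast
    qed
  qed
  with M that show thesis by blast
qed

text \<open>After localizing at a minimal prime \<open>p\<close>, every element of \<open>p\<close>
  is nilpotent modulo \<open>J\<close>. Otherwise \<open>J\<close> misses the multiplicative set of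
  all t x^k with t outside \<open>p\<close>, and a prime over \<open>J\<close> missing that set is
  contained in \<open>p\<close> but omits \<open>x\<close>, against minimality.\<close>

lemma minimal_over_nilpotent:
  assumes J: "is_ideal J" and p: "minimal_over J p" and x: "x \<in> p"
  obtains t k where "t \<in> P - p" "t * x ^ k \<in> J"
proof -
  have pp: "is_prime p" and Jp: "J \<subseteq> p"
    and pmin: "\<And>q. is_prime q \<Longrightarrow> J \<subseteq> q \<Longrightarrow> q \<subseteq> p \<Longrightarrow> q = p"
    using p by (auto simp: minimal_over_def)
  have xP: "x \<in> P" using x is_idealD(6) is_primeD(1)[OF pp] by blast
  let ?S = "{t * x ^ k | t k. t \<in> P - p}"
  have "J \<inter> ?S \<noteq> {}"
  proof
    assume disj: "J \<inter> ?S = {}"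
    have one: "1 \<in> P - p" using is_primeD(2)[OF pp] by simp
    have m: "u * v \<in> ?S" if uv: "u \<in> ?S" "v \<in> ?S" for u v
    proof -
      obtain t k t' k' where *: "u = t * x ^ k" "v = t' * x ^ k'" "t \<in> P - p" "t' \<in> P - p"
        using uv by blast
      then have "t * t' \<in> P - p" using is_primeD(3)[OF pp, of t t'] by auto
      moreover have "u * v = (t * t') * x ^ (k + k')" by (simp add: * power_add algebra_simps)
      ultimately show ?thesis by blast
    qed
    have "1 = 1 * x ^ 0" by simp
    then have "1 \<in> ?S" using one by blast
    moreover have "?S \<subseteq> P" using xP by auto
    ultimately obtain q where q: "is_prime q" "J \<subseteq> q" "q \<inter> ?S = {}"
      using exists_prime_disjoint[OF J _ _ m disj] by blast
    have "q \<subseteq> p"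
    proof
      fix t assume t: "t \<in> q"
      show "t \<in> p"
      proof (rule ccontr)
        assume "t \<notin> p"
        then have "t * x ^ 0 \<in> ?S" using t is_idealD(6)[OF is_primeD(1)[OF q(1)]] by blast
        then show False using t q(3) by auto
      qed
    qed
    then have "q = p" using pmin q by blast
    moreover have "1 * x ^ 1 \<in> ?S" using one by blast
    then have "x \<notin> q" using q(3) by auto
    ultimately show False using x by blast
  qed
  then show thesis using that by blast
qed

text \<open>Minimal primes consist of zero divisors: a nonzerodivisor power could be cancelled from
  t x^k in \<open>J\<close>, which would put \<open>t\<close> into \<open>p\<close>.\<close>

lemma minimal_over_not_mem:
  assumes "is_ideal J" "minimal_over J p" "x \<in> P" "nonzerodiv J x"
  shows "x \<notin> p"
proof
  assume "x \<in> p"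
  then obtain t k where t: "t \<in> P - p" "t * x ^ k \<in> J"
    using minimal_over_nilpotent assms by blast
  then have "t \<in> J" using nonzerodivD[OF nonzerodiv_power[OF assms(3,4)], of t k]
    by (simp add: mult.commute)
  then show False using t assms(2) by (auto simp: minimal_over_def)
qed

text \<open>The half of exchanging two neighbours of a regular sequence that holds for arbitrary
  elements. From x m = q + y m' one gets m' in J + (x), say m' = q' + x m''; then x (m - y m'') lies
  in \<open>J\<close> and \<open>x\<close> can be cancelled.\<close>

lemma nonzerodiv_adjoin_swap:
  assumes J: "is_ideal J" and xy: "x \<in> P" "y \<in> P" and x: "nonzerodiv J x" and y: "nonzerodiv (adjoin J x) y"
  shows "nonzerodiv (adjoin J y) x"
  unfolding nonzerodiv_def
proof (intro ballI impI)
  fix m assume m: "m \<in> P" "x * m \<in> adjoin J y"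
  then obtain q m' where 1: "x * m = q + y * m'" "q \<in> J" "m' \<in> P" by (auto simp: adjoin_def)
  have "y * m' = - q + x * m" using 1 by simp
  also have "\<dots> \<in> adjoin J x" using 1(2) m(1) is_idealD(7)[OF J] by (intro adjoin_memI) auto
  finally have "m' \<in> adjoin J x" using y 1 nonzerodivD by blast
  then obtain q' m'' where 2: "m' = q' + x * m''" "q' \<in> J" "m'' \<in> P" by (auto simp: adjoin_def)
  have "x * (m - y * m'') = q + y * q'" using 1 2 by (simp add: algebra_simps)
  also have "\<dots> \<in> J" using 1 2 xy is_idealD(3,4)[OF J] by auto
  finally have "m - y * m'' \<in> J" using nonzerodivD[OF x, of "m - y * m''"] m 2 xy by auto
  then show "m \<in> adjoin J y" using adjoin_memI[of "m - y * m''" J m'' y] 2 by simp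
qed

end

section \<open>Homogeneous ideals and regular sequences\<close>

lemma mon_deg_superset:
  assumes "finite A" "Poly_Mapping.keys t \<subseteq> A"
  shows "mon_deg t = (\<Sum>i\<in>A. Poly_Mapping.lookup t i)"
  unfolding mon_deg_def using assms by (intro sum.mono_neutral_left) (auto simp: in_keys_iff)

lemma mon_deg_add: "mon_deg (s + t) = mon_deg s + mon_deg t"
proof -
  let ?A = "Poly_Mapping.keys s \<union> Poly_Mapping.keys t"
  have "mon_deg u = (\<Sum>i\<in>?A. Poly_Mapping.lookup u i)" if "Poly_Mapping.keys u \<subseteq> ?A" for u
    using that by (intro mon_deg_superset) auto
  then show ?thesis
    using Poly_Mapping.keys_add[of s t] by (simp add: lookup_add sum.distrib)
qed

lemma mon_deg_zero [simp]: "mon_deg 0 = 0"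
  by (simp add: mon_deg_def)

lemma homogeneous_mult:
  fixes p q :: "('k::comm_semiring_1) mpol"
  assumes "homogeneous d p" "homogeneous e q"
  shows "homogeneous (d + e) (p * q)"
  unfolding homogeneous_def
proof
  fix t assume "t \<in> Poly_Mapping.keys (p * q)"
  then obtain u v where "t = u + v" "u \<in> Poly_Mapping.keys p" "v \<in> Poly_Mapping.keys q"
    using keys_mult[of p q] by blast
  then show "mon_deg t = d + e" using assms by (simp add: homogeneous_def mon_deg_add)
qed

lemma homogeneous_one: "homogeneous 0 (1 :: ('k::comm_semiring_1) mpol)"
  by (simp add: homogeneous_def)

lemma homogeneous_power:
  fixes p :: "('k::comm_semiring_1) mpol"
  shows "homogeneous d p \<Longrightarrow> homogeneous (k * d) (p ^ k)"
proof (induction k)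
  case (Suc k)
  then show ?case using homogeneous_mult[of d p "k * d" "p ^ k"] by simp
qed (simp add: homogeneous_one)

section \<open>Homogeneous components\<close>

definition hcomp :: "nat \<Rightarrow> ('k::comm_ring_1) mpol \<Rightarrow> 'k mpol" where
  "hcomp d p = (\<Sum>t | t \<in> Poly_Mapping.keys p \<and> mon_deg t = d. Poly_Mapping.single t (Poly_Mapping.lookup p t))"

lemma lookup_sum_poly: "Poly_Mapping.lookup (sum f A) t = (\<Sum>i\<in>A. Poly_Mapping.lookup (f i) t)"
  by (induction A rule: infinite_finite_induct) (auto simp: lookup_add)

lemma lookup_hcomp:
  "Poly_Mapping.lookup (hcomp d p) t = (if mon_deg t = d then Poly_Mapping.lookup p t else 0)"
proof -
  let ?A = "{t. t \<in> Poly_Mapping.keys p \<and> mon_deg t = d}"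
  have fin: "finite ?A" by simp
  have "Poly_Mapping.lookup (hcomp d p) t = (\<Sum>u\<in>?A. if u = t then Poly_Mapping.lookup p u else 0)"
    unfolding hcomp_def lookup_sum_poly by (intro sum.cong) (auto simp: lookup_single when_def)
  also have "\<dots> = (if t \<in> ?A then Poly_Mapping.lookup p t else 0)"
    using fin by simp
  finally show ?thesis by (auto simp: in_keys_iff)
qed

lemma hcomp_add: "hcomp d (p + q) = hcomp d p + hcomp d q"
  by (rule poly_mapping_eqI) (simp add: lookup_hcomp lookup_add)

lemma hcomp_sum: "hcomp d (sum f A) = (\<Sum>i\<in>A. hcomp d (f i))"
  by (rule poly_mapping_eqI) (simp add: lookup_hcomp lookup_sum_poly)

lemma hcomp_homogeneous: "homogeneous e p \<Longrightarrow> hcomp d p = (if d = e then p else 0)"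
  by (rule poly_mapping_eqI) (auto simp: lookup_hcomp homogeneous_def in_keys_iff)

lemma homogeneous_hcomp: "homogeneous d (hcomp d p)"
  by (auto simp: homogeneous_def in_keys_iff lookup_hcomp split: if_splits)

lemma keys_hcomp: "Poly_Mapping.keys (hcomp d p) \<subseteq> Poly_Mapping.keys p"
  by (auto simp: in_keys_iff lookup_hcomp split: if_splits)

lemma poly_eq_sum_hcomp: "p = (\<Sum>d\<in>mon_deg ` Poly_Mapping.keys p. hcomp d p)"
proof (rule poly_mapping_eqI)
  fix t
  have "(\<Sum>d\<in>mon_deg ` Poly_Mapping.keys p. Poly_Mapping.lookup (hcomp d p) t) =
      (if mon_deg t \<in> mon_deg ` Poly_Mapping.keys p then Poly_Mapping.lookup p t else 0)"
    by (simp add: lookup_hcomp)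
  then show "Poly_Mapping.lookup p t = Poly_Mapping.lookup (\<Sum>d\<in>mon_deg ` Poly_Mapping.keys p. hcomp d p) t"
    by (auto simp: lookup_sum_poly in_keys_iff)
qed

text \<open>Multiplication by a form shifts degrees by \<open>e\<close>; after \<open>p\<close> is
  split into components, only the one of degree d - e contributes.\<close>

lemma hcomp_mult_homogeneous:
  fixes p x :: "('k::comm_ring_1) mpol"
  assumes "homogeneous e x"
  shows "hcomp d (x * p) = (if e \<le> d then x * hcomp (d - e) p else 0)"
proof -
  let ?D = "mon_deg ` Poly_Mapping.keys p"
  have "hcomp d (x * p) = hcomp d (\<Sum>\<delta>\<in>?D. x * hcomp \<delta> p)"
    by (subst poly_eq_sum_hcomp[of p]) (simp add: sum_distrib_left)
  also have "\<dots> = (\<Sum>\<delta>\<in>?D. if d = e + \<delta> then x * hcomp \<delta> p else 0)"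
    unfolding hcomp_sum
    by (intro sum.cong refl hcomp_homogeneous homogeneous_mult assms homogeneous_hcomp)
  also have "\<dots> = (if e \<le> d then x * hcomp (d - e) p else 0)"
  proof (cases "e \<le> d")
    case True
    then have "(\<Sum>\<delta>\<in>?D. if d = e + \<delta> then x * hcomp \<delta> p else 0) =
        (\<Sum>\<delta>\<in>?D. if \<delta> = d - e then x * hcomp \<delta> p else 0)"
      by (intro sum.cong) auto
    also have "\<dots> = (if d - e \<in> ?D then x * hcomp (d - e) p else 0)" by simp
    also have "\<dots> = x * hcomp (d - e) p"
    proof (cases "d - e \<in> ?D")
      case False
      then have "mon_deg t \<noteq> d - e" if "t \<in> Poly_Mapping.keys p" for t
        using that by (metis imageI)
      then have "hcomp (d - e) p = 0"
        unfolding hcomp_def by (intro sum.neutral) auto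
      then show ?thesis by simp
    qed simp
    finally show ?thesis using True by simp
  qed (auto intro!: sum.neutral)
  finally show ?thesis .
qed

text \<open>\<open>K\<close> carries the coefficient type, so that \<open>R\<close> denotes one
  fixed ring throughout.\<close>

locale poly_vars =
  fixes n :: nat and K :: "'k::field itself"
begin

abbreviation R :: "'k mpol ring" where
  "R \<equiv> mpoly_ring n"

lemma carrier_R: "carrier R = {p. \<forall>t\<in>Poly_Mapping.keys p. Poly_Mapping.keys t \<subseteq> {..n}}"
  and mult_R: "x \<otimes>\<^bsub>R\<^esub> y = x * y" and add_R: "x \<oplus>\<^bsub>R\<^esub> y = x + y"
  and one_R: "\<one>\<^bsub>R\<^esub> = 1" and zero_R: "\<zero>\<^bsub>R\<^esub> = 0"
  by (simp_all add: mpoly_ring_def ring_of_type_algebra_def)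

lemma cring_R: "cring R"
  by (rule cring_mpoly_ring)

sublocale subring_carrier "carrier R"
proof -
  interpret R: cring R by (rule cring_R)
  show "subring_carrier (carrier R)"
  proof
    show "0 \<in> carrier R" "1 \<in> carrier R" by (auto simp: carrier_R)
    show "- x \<in> carrier R" if "x \<in> carrier R" for x using that by (simp add: carrier_R)
    show "x + y \<in> carrier R" "x * y \<in> carrier R" if "x \<in> carrier R" "y \<in> carrier R" for x y
      using R.a_closed[OF that] R.m_closed[OF that] by (simp_all add: add_R mult_R)
  qed
qed

lemma hcomp_mem: "p \<in> carrier R \<Longrightarrow> hcomp d p \<in> carrier R"
  using keys_hcomp[of d p] by (auto simp: carrier_R)

section \<open>Homogeneous ideals and the order of a regular sequence\<close>

definition hom_ideal :: "'k mpol set \<Rightarrow> bool" where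
  "hom_ideal Q \<longleftrightarrow> is_ideal Q \<and> (\<forall>p\<in>Q. \<forall>d. hcomp d p \<in> Q)"

definition is_form :: "'k mpol \<Rightarrow> bool" where
  "is_form x \<longleftrightarrow> x \<in> carrier R \<and> (\<exists>d>0. homogeneous d x)"

lemma hom_ideal_is_ideal: "hom_ideal Q \<Longrightarrow> is_ideal Q"
  by (simp add: hom_ideal_def)

lemma is_form_mem: "is_form x \<Longrightarrow> x \<in> carrier R"
  by (simp add: is_form_def)

lemma is_form_power: "is_form x \<Longrightarrow> k > 0 \<Longrightarrow> is_form (x ^ k)"
proof -
  assume "is_form x" "k > 0"
  then obtain d where "x \<in> carrier R" "d > 0" "homogeneous d x" by (auto simp: is_form_def)
  then have "x ^ k \<in> carrier R \<and> k * d > 0 \<and> homogeneous (k * d) (x ^ k)"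
    using \<open>k > 0\<close> by (simp add: homogeneous_power)
  then show ?thesis unfolding is_form_def by blast
qed

lemma hom_ideal_zero: "hom_ideal {0}"
  using is_ideal_zero by (auto simp: hom_ideal_def hcomp_def)

lemma hom_ideal_adjoin:
  assumes Q: "hom_ideal Q" and x: "is_form x"
  shows "hom_ideal (adjoin Q x)"
  unfolding hom_ideal_def
proof (intro conjI ballI allI)
  show "is_ideal (adjoin Q x)" using Q x by (intro is_ideal_adjoin) (auto simp: hom_ideal_def is_form_def)
  fix p d assume "p \<in> adjoin Q x"
  then obtain q r where p: "p = q + x * r" "q \<in> Q" "r \<in> carrier R" by (auto simp: adjoin_def)
  obtain e where e: "homogeneous e x" using x by (auto simp: is_form_def)
  have "hcomp d p = hcomp d q + x * (if e \<le> d then hcomp (d - e) r else 0)"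
    using p by (simp add: hcomp_add hcomp_mult_homogeneous[OF e])
  also have "\<dots> \<in> adjoin Q x"
    using p Q by (intro adjoin_memI) (auto simp: hom_ideal_def hcomp_mem)
  finally show "hcomp d p \<in> adjoin Q x" .
qed

lemma hom_ideal_adjoin_list:
  "hom_ideal Q \<Longrightarrow> \<forall>x\<in>set xs. is_form x \<Longrightarrow> hom_ideal (adjoin_list Q xs)"
  by (induction xs arbitrary: Q) (simp_all add: hom_ideal_adjoin)

text \<open>In degrees below \<open>i\<close> the ideals \<open>Q\<close> and \<open>Q + (x\<^sup>i)\<close> agree.\<close>

lemma hom_ideal_separated:
  assumes Q: "hom_ideal Q" and x: "is_form x" and m: "\<And>i. m \<in> adjoin Q (x ^ i)"
  shows "m \<in> Q"
proof -
  have comp: "hcomp d m \<in> Q" for d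
  proof -
    obtain q r where *: "m = q + x ^ Suc d * r" "q \<in> Q" "r \<in> carrier R"
      using m[of "Suc d"] by (auto simp: adjoin_def)
    obtain e where e: "homogeneous e x" "e > 0" using x by (auto simp: is_form_def)
    have "\<not> Suc d * e \<le> d" using e(2) by (cases e) auto
    then have "hcomp d m = hcomp d q"
      using * hcomp_mult_homogeneous[OF homogeneous_power[OF e(1)], of d "Suc d" r]
      by (simp add: hcomp_add)
    then show ?thesis using * Q by (simp add: hom_ideal_def)
  qed
  have sums: "sum f A \<in> Q" if "\<And>i. i \<in> A \<Longrightarrow> f i \<in> Q" for f :: "nat \<Rightarrow> 'k mpol" and A
    using that
  proof (induction A rule: infinite_finite_induct)
    case (insert i A)
    then show ?case using is_idealD(3)[OF hom_ideal_is_ideal[OF Q]] by simp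
  qed (use is_idealD(2)[OF hom_ideal_is_ideal[OF Q]] in simp_all)
  have "(\<Sum>d\<in>mon_deg ` Poly_Mapping.keys m. hcomp d m) \<in> Q"
    by (intro sums comp)
  then show ?thesis by (simp flip: poly_eq_sum_hcomp)
qed

text \<open>The other half of the exchange, where homogeneity enters. If y m lies in
  \<open>Q\<close>, then \<open>m\<close> can be divided by \<open>x\<close> again and again: m = q
  + x^i r with y r still in \<open>Q\<close>. So \<open>m\<close> lies in every Q + (x^i), and these
  ideals intersect in \<open>Q\<close> by \<open>hom_ideal_separated\<close>.\<close>

lemma nonzerodiv_swap:
  assumes Q: "hom_ideal Q" and x: "is_form x" and y: "y \<in> carrier R"
    and nx: "nonzerodiv Q x" and ny: "nonzerodiv (adjoin Q x) y"
  shows "nonzerodiv Q y"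
  unfolding nonzerodiv_def
proof (intro ballI impI)
  fix m assume m: "m \<in> carrier R" "y * m \<in> Q"
  have xR: "x \<in> carrier R" using x by (rule is_form_mem)
  have I: "is_ideal Q" using Q by (rule hom_ideal_is_ideal)
  have "\<exists>q r. q \<in> Q \<and> r \<in> carrier R \<and> m = q + x ^ i * r \<and> y * r \<in> Q" for i
  proof (induction i)
    case 0
    then show ?case using m is_idealD(2)[OF I] by (intro exI[of _ 0] exI[of _ m]) simp
  next
    case (Suc i)
    then obtain q r where *: "q \<in> Q" "r \<in> carrier R" "m = q + x ^ i * r" "y * r \<in> Q" by blast
    have "r \<in> adjoin Q x"
      using nonzerodivD[OF ny *(2)] *(4) adjoin_superset by blast
    then obtain q' r' where **: "r = q' + x * r'" "q' \<in> Q" "r' \<in> carrier R" by (auto simp: adjoin_def)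
    have "x * (y * r') = y * r - y * q'" by (simp add: ** algebra_simps)
    also have "\<dots> \<in> Q" using * ** is_idealD(4,8)[OF I] y by blast
    finally have "y * r' \<in> Q" using nonzerodivD[OF nx] y ** by simp
    moreover have "m = (q + x ^ i * q') + x ^ Suc i * r'" by (simp add: * ** algebra_simps)
    moreover have "q + x ^ i * q' \<in> Q" using * ** is_idealD(3,4)[OF I] xR by simp
    ultimately show ?case using ** by blast
  qed
  then have "m \<in> adjoin Q (x ^ i)" for i unfolding adjoin_def by blast
  then show "m \<in> Q" by (rule hom_ideal_separated[OF Q x])
qed

text \<open>The element \<open>y\<close> passes its left neighbours one at a time; each exchange
  combines \<open>nonzerodiv_swap\<close> for the new first element with
  \<open>nonzerodiv_adjoin_swap\<close> for the second.\<close>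

lemma regseq_move_front:
  assumes "hom_ideal Q" "\<forall>x\<in>set xs. is_form x" "is_form y" "regseq Q (xs @ y # zs)"
  shows "regseq Q (y # xs @ zs)"
  using assms
proof (induction xs arbitrary: Q)
  case (Cons x xs)
  have Q': "hom_ideal (adjoin Q x)" using Cons.prems by (auto intro: hom_ideal_adjoin)
  then have IH: "nonzerodiv (adjoin Q x) y" "regseq (adjoin (adjoin Q x) y) (xs @ zs)"
    using Cons.IH[of "adjoin Q x"] Cons.prems by auto
  have nx: "nonzerodiv Q x" and xy: "is_form x" "x \<in> carrier R" "y \<in> carrier R"
    using Cons.prems by (auto intro: is_form_mem)
  have "nonzerodiv Q y"
    using nonzerodiv_swap[OF Cons.prems(1) xy(1,3) nx IH(1)] .
  moreover have "nonzerodiv (adjoin Q y) x"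
    using nonzerodiv_adjoin_swap[OF hom_ideal_is_ideal[OF Cons.prems(1)] xy(2,3) nx IH(1)] .
  ultimately show ?case using IH(2) adjoin_commute[of Q x y] by simp
qed simp

lemma regseq_permute:
  assumes "hom_ideal Q" "\<forall>x\<in>set xs. is_form x" "regseq Q xs" "mset xs = mset ys"
  shows "regseq Q ys"
  using assms
proof (induction ys arbitrary: Q xs)
  case (Cons y ys)
  then have "y \<in> set xs" by (metis list.set_intros(1) set_mset_mset)
  then obtain as bs where xs: "xs = as @ y # bs" by (meson split_list)
  have "regseq Q (y # as @ bs)"
    using Cons.prems xs by (intro regseq_move_front) auto
  moreover have "hom_ideal (adjoin Q y)" using Cons.prems xs by (auto intro: hom_ideal_adjoin)
  moreover have "mset (as @ bs) = mset ys" using Cons.prems xs by simp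
  ultimately show ?case using Cons.IH[of "adjoin Q y" "as @ bs"] Cons.prems xs by auto
qed simp

text \<open>With \<open>f\<close> moved to the last place, replacing it by a power changes no later
  quotient and only needs that powers of nonzerodivisors are nonzerodivisors; the sequence is then
  permuted back.\<close>

lemma regseq_power:
  assumes "hom_ideal Q" "\<forall>x\<in>set (xs @ f # ys). is_form x" "regseq Q (xs @ f # ys)" "M > 0"
  shows "regseq Q (xs @ f ^ M # ys)"
proof -
  have "regseq Q ((xs @ ys) @ [f])" using assms by (intro regseq_permute[OF assms(1-3)]) auto
  then have "regseq Q ((xs @ ys) @ [f ^ M])"
    using assms(2) by (auto simp: regseq_append is_form_mem intro!: nonzerodiv_power)
  moreover have "\<forall>x\<in>set ((xs @ ys) @ [f ^ M]). is_form x"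
    using assms(2,4) is_form_power[of f M] by auto
  moreover have "mset ((xs @ ys) @ [f ^ M]) = mset (xs @ f ^ M # ys)" by simp
  ultimately show ?thesis using regseq_permute[OF assms(1)] by blast
qed

section \<open>The irrelevant ideal\<close>

definition irrelevant_ideal :: "'k mpol set" where
  "irrelevant_ideal = {p \<in> carrier R. Poly_Mapping.lookup p 0 = 0}"

lemma is_ideal_irrelevant: "is_ideal irrelevant_ideal"
  unfolding is_ideal_def
proof (intro conjI ballI)
  fix r x assume r: "r \<in> carrier R" and x: "x \<in> irrelevant_ideal"
  have "0 \<notin> Poly_Mapping.keys (r * x)"
  proof
    assume "0 \<in> Poly_Mapping.keys (r * x)"
    then obtain u v where uv: "u + v = 0" "v \<in> Poly_Mapping.keys x"
      using keys_mult[of r x] by fastforce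
    \<comment> \<open>Exponents are natural numbers, so a sum of exponent vectors vanishes only if
      both vanish.\<close>
    have "Poly_Mapping.lookup v i = 0" for i
      using arg_cong[OF uv(1), of "\<lambda>t. Poly_Mapping.lookup t i"] by (simp add: lookup_add)
    then have "v = 0" by (intro poly_mapping_eqI) simp
    then show False using uv x by (simp add: irrelevant_ideal_def in_keys_iff)
  qed
  then show "r * x \<in> irrelevant_ideal" using r x by (simp add: irrelevant_ideal_def in_keys_iff)
qed (auto simp: irrelevant_ideal_def lookup_add)

lemma is_form_irrelevant: "is_form x \<Longrightarrow> x \<in> irrelevant_ideal"
proof -
  assume "is_form x"
  then obtain d where "d > 0" "homogeneous d x" and xR: "x \<in> carrier R" by (auto simp: is_form_def)
  then have "0 \<notin> Poly_Mapping.keys x" unfolding homogeneous_def by force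
  then show ?thesis using xR by (simp add: irrelevant_ideal_def in_keys_iff)
qed

lemma one_not_irrelevant: "1 \<notin> irrelevant_ideal"
  by (simp add: irrelevant_ideal_def lookup_one)

end

section \<open>Algebraic independence\<close>

primrec monomial :: "('k::comm_semiring_1) mpol list \<Rightarrow> nat list \<Rightarrow> 'k mpol" where
  "monomial [] \<alpha> = 1"
| "monomial (z # zs) \<alpha> = z ^ hd \<alpha> * monomial zs (tl \<alpha>)"

text \<open>Each exponent is bounded separately, rather than the total degree: this makes the set a
  product, so that it splits along the list and has a power as its cardinality.\<close>

definition exponents :: "nat \<Rightarrow> nat \<Rightarrow> nat list set" where
  "exponents t k = {\<alpha>. set \<alpha> \<subseteq> {..t} \<and> length \<alpha> = k}"

text \<open>The value at \<open>zs\<close> of a polynomial with coefficients \<open>c\<close> and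
  degree at most \<open>t\<close> in each variable; \<open>Poly_Mapping.single 0\<close> embeds
  scalars as constants.\<close>

definition evaluate :: "nat \<Rightarrow> (nat list \<Rightarrow> 'k::comm_semiring_1) \<Rightarrow> 'k mpol list \<Rightarrow> 'k mpol" where
  "evaluate t c zs = (\<Sum>\<alpha>\<in>exponents t (length zs). Poly_Mapping.single 0 (c \<alpha>) * monomial zs \<alpha>)"

lemma finite_exponents: "finite (exponents t k)"
  unfolding exponents_def using finite_lists_length_eq[of "{..t}" k] by simp

lemma card_exponents: "card (exponents t k) = Suc t ^ k"
  unfolding exponents_def using card_lists_length_eq[of "{..t}" k] by simp

lemma exponents_0: "exponents t 0 = {[]}"
  by (auto simp: exponents_def)

lemma exponents_Suc: "exponents t (Suc k) = (\<lambda>(i, \<beta>). i # \<beta>) ` ({..t} \<times> exponents t k)"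
  by (force simp: exponents_def length_Suc_conv image_iff)

lemma evaluate_Nil: "evaluate t c [] = Poly_Mapping.single 0 (c [])"
  by (simp add: evaluate_def exponents_0)

lemma evaluate_Cons:
  "evaluate t c (z # zs) = (\<Sum>i\<le>t. z ^ i * evaluate t (\<lambda>\<beta>. c (i # \<beta>)) zs)"
proof -
  let ?E = "exponents t (length zs)"
  have "evaluate t c (z # zs) =
      (\<Sum>(i, \<beta>)\<in>{..t} \<times> ?E. Poly_Mapping.single 0 (c (i # \<beta>)) * (z ^ i * monomial zs \<beta>))"
    unfolding evaluate_def
    by (simp add: exponents_Suc, subst sum.reindex) (auto simp: inj_on_def case_prod_beta)
  also have "\<dots> = (\<Sum>i\<le>t. \<Sum>\<beta>\<in>?E. z ^ i * (Poly_Mapping.single 0 (c (i # \<beta>)) * monomial zs \<beta>))"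
    by (simp add: sum.cartesian_product ac_simps)
  finally show ?thesis by (simp add: evaluate_def sum_distrib_left)
qed

context poly_vars
begin

section \<open>Polynomial relations modulo an ideal\<close>

lemma single_mem: "Poly_Mapping.single 0 c \<in> carrier R"
  by (auto simp: carrier_R)

lemma monomial_mem: "set zs \<subseteq> carrier R \<Longrightarrow> monomial zs \<alpha> \<in> carrier R"
  by (induction zs arbitrary: \<alpha>) auto

lemma evaluate_mem: "set zs \<subseteq> carrier R \<Longrightarrow> evaluate t c zs \<in> carrier R"
  unfolding evaluate_def by (intro sum_mem mult_mem single_mem monomial_mem)

text \<open>Independence, over the coefficient field, of the residue classes of \<open>zs\<close>
  modulo \<open>Q\<close>.\<close>

definition algebraically_independent :: "'k mpol set \<Rightarrow> 'k mpol list \<Rightarrow> bool" where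
  "algebraically_independent Q zs \<longleftrightarrow>
     (\<forall>t c. evaluate t c zs \<in> Q \<longrightarrow> (\<forall>\<alpha>\<in>exponents t (length zs). c \<alpha> = 0))"

text \<open>Sorted by powers of \<open>z\<close>, the polynomial is divisible by z^e, where
  \<open>e\<close> is the least exponent of \<open>z\<close> that occurs with a nonzero coefficient.
  What remains is a nontrivial polynomial in \<open>zs\<close> plus a multiple of
  \<open>z\<close>.\<close>

lemma evaluate_Cons_factor:
  assumes "set (z # zs) \<subseteq> carrier R" "\<alpha> \<in> exponents t (length (z # zs))" "c \<alpha> \<noteq> 0"
  obtains e c' \<beta> v where "evaluate t c (z # zs) = z ^ e * (evaluate t c' zs + z * v)"
    "\<beta> \<in> exponents t (length zs)" "c' \<beta> \<noteq> 0" "v \<in> carrier R"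
proof -
  define A where "A = {i. i \<le> t \<and> (\<exists>\<beta>\<in>exponents t (length zs). c (i # \<beta>) \<noteq> 0)}"
  define e where "e = (LEAST i. i \<in> A)"
  have "\<exists>i. i \<in> A" using assms(2,3) by (auto simp: A_def exponents_Suc)
  then have eA: "e \<in> A" unfolding e_def by (rule LeastI_ex)
  have less: "i \<notin> A" if "i < e" for i using not_less_Least that unfolding e_def by blast
  let ?P = "\<lambda>i. evaluate t (\<lambda>\<beta>. c (i # \<beta>)) zs"
  define v where "v = (\<Sum>i\<in>{e<..t}. z ^ (i - Suc e) * ?P i)"
  have zero: "?P i = 0" if "i < e" for i
    using less[OF that] that eA unfolding evaluate_def by (intro sum.neutral) (auto simp: A_def)
  have split: "{..t} = {..<e} \<union> insert e {e<..t}" using eA by (auto simp: A_def)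
  have "evaluate t c (z # zs) = (\<Sum>i<e. z ^ i * ?P i) + (z ^ e * ?P e + (\<Sum>i\<in>{e<..t}. z ^ i * ?P i))"
    unfolding evaluate_Cons split by (subst sum.union_disjoint) auto
  also have "(\<Sum>i<e. z ^ i * ?P i) = 0" by (intro sum.neutral) (simp add: zero)
  also have "(\<Sum>i\<in>{e<..t}. z ^ i * ?P i) = z ^ e * (z * v)"
    unfolding v_def sum_distrib_left
  proof (intro sum.cong refl)
    fix i assume "i \<in> {e<..t}"
    then have "z ^ i = z ^ (Suc e + (i - Suc e))" by simp
    then have "z ^ i = z ^ e * z * z ^ (i - Suc e)" by (simp only: power_add power_Suc2)
    then show "z ^ i * ?P i = z ^ e * (z * (z ^ (i - Suc e) * ?P i))" by (simp add: mult.assoc)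
  qed
  finally have eq: "evaluate t c (z # zs) = z ^ e * (?P e + z * v)" by (simp add: algebra_simps)
  obtain \<beta> where "\<beta> \<in> exponents t (length zs)" "c (e # \<beta>) \<noteq> 0" using eA by (auto simp: A_def)
  moreover have "v \<in> carrier R"
    unfolding v_def using assms(1) by (intro sum_mem mult_mem power_mem evaluate_mem) auto
  ultimately show thesis using that[OF eq] by blast
qed

text \<open>In a relation modulo \<open>Q\<close> the power of \<open>z\<close> given by
  \<open>evaluate_Cons_factor\<close> can be cancelled; reduction modulo \<open>z\<close> then
  leaves a nontrivial relation among \<open>zs\<close> modulo Q + (z).\<close>

lemma algebraically_independent_Cons:
  assumes "is_ideal Q" "set (z # zs) \<subseteq> carrier R" "nonzerodiv Q z"
    and indep: "algebraically_independent (adjoin Q z) zs"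
  shows "algebraically_independent Q (z # zs)"
  unfolding algebraically_independent_def
proof (intro allI impI ballI, rule ccontr)
  fix t c \<alpha>
  assume *: "evaluate t c (z # zs) \<in> Q" "\<alpha> \<in> exponents t (length (z # zs))" "c \<alpha> \<noteq> 0"
  obtain e c' \<beta> v where **: "evaluate t c (z # zs) = z ^ e * (evaluate t c' zs + z * v)"
    "\<beta> \<in> exponents t (length zs)" "c' \<beta> \<noteq> 0" "v \<in> carrier R"
    by (rule evaluate_Cons_factor[where c = c, OF assms(2) *(2,3)])
  have z: "z \<in> carrier R" "set zs \<subseteq> carrier R" using assms(2) by auto
  have "evaluate t c' zs + z * v \<in> carrier R" using **(4) z by (simp add: evaluate_mem)
  then have "evaluate t c' zs + z * v \<in> Q"
    using nonzerodivD[OF nonzerodiv_power[OF z(1) assms(3)]] *(1) **(1) by metis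
  then have "(evaluate t c' zs + z * v) + z * (- v) \<in> adjoin Q z"
    using ** by (intro adjoin_memI) auto
  then have "evaluate t c' zs \<in> adjoin Q z" by simp
  then show False using indep ** by (auto simp: algebraically_independent_def)
qed

lemma algebraically_independent_regseq:
  assumes "is_ideal Q" "set (xs @ zs) \<subseteq> carrier R" "regseq Q xs"
    and "algebraically_independent (adjoin_list Q xs) zs"
  shows "algebraically_independent Q (xs @ zs)"
  using assms
proof (induction xs arbitrary: Q)
  case (Cons x xs)
  then have "algebraically_independent (adjoin Q x) (xs @ zs)"
    by (auto intro: is_ideal_adjoin)
  then show ?case using Cons.prems algebraically_independent_Cons[of Q x "xs @ zs"] by auto
qed simp

lemma algebraically_independent_antimono:
  "algebraically_independent Q zs \<Longrightarrow> Q' \<subseteq> Q \<Longrightarrow> algebraically_independent Q' zs"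
  unfolding algebraically_independent_def by blast

text \<open>Write the value as y^e (u + y v), where \<open>u\<close> is a nontrivial polynomial in
  the remaining forms. By induction \<open>u\<close>, and with it u + y v, is a nonzerodivisor
  modulo Q + (y), and \<open>nonzerodiv_swap\<close> brings this down to \<open>Q\<close>. In the
  base case the value is a nonzero constant, hence a unit.\<close>

lemma evaluate_nonzerodiv:
  assumes "hom_ideal Q" "\<forall>y\<in>set ys. is_form y" "regseq Q ys"
    and "\<alpha> \<in> exponents t (length ys)" "c \<alpha> \<noteq> 0"
  shows "nonzerodiv Q (evaluate t c ys)"
  using assms
proof (induction ys arbitrary: Q c \<alpha>)
  case Nil
  then have c: "c [] \<noteq> 0" by (simp add: exponents_0)
  show ?case
    unfolding nonzerodiv_def evaluate_Nil
  proof (intro ballI impI)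
    fix r assume r: "r \<in> carrier R" "Poly_Mapping.single 0 (c []) * r \<in> Q"
    have "Poly_Mapping.single 0 (inverse (c [])) * (Poly_Mapping.single 0 (c []) * r) \<in> Q"
      using is_idealD(4)[OF hom_ideal_is_ideal[OF Nil(1)] single_mem r(2)] .
    then show "r \<in> Q" using c by (simp add: mult_single flip: mult.assoc)
  qed
next
  case (Cons y ys)
  have y: "is_form y" "y \<in> carrier R" "set (y # ys) \<subseteq> carrier R"
    using Cons.prems(2) by (auto intro: is_form_mem)
  have ny: "nonzerodiv Q y" using Cons.prems(3) by simp
  have Q: "is_ideal Q" using Cons.prems(1) by (rule hom_ideal_is_ideal)
  obtain e c' \<beta> v where *: "evaluate t c (y # ys) = y ^ e * (evaluate t c' ys + y * v)"
    "\<beta> \<in> exponents t (length ys)" "c' \<beta> \<noteq> 0" "v \<in> carrier R"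
    by (rule evaluate_Cons_factor[where c = c, OF y(3) Cons.prems(4,5)])
  let ?u = "evaluate t c' ys + y * v"
  have uR: "evaluate t c' ys \<in> carrier R" "?u \<in> carrier R" using *(4) y by (simp_all add: evaluate_mem)
  have IH: "nonzerodiv (adjoin Q y) (evaluate t c' ys)"
    using Cons.prems by (intro Cons.IH[where c = c', OF hom_ideal_adjoin[OF Cons.prems(1) y(1)] _ _ *(2,3)]) auto
  have "nonzerodiv (adjoin Q y) ?u"
    unfolding nonzerodiv_def
  proof (intro ballI impI)
    fix r assume r: "r \<in> carrier R" "?u * r \<in> adjoin Q y"
    have Q': "is_ideal (adjoin Q y)" by (rule is_ideal_adjoin[OF Q y(2)])
    have "y * (v * r) \<in> adjoin Q y"
      using r * by (intro is_idealD(5)[OF Q'] adjoin_mem is_idealD(2)[OF Q]) simp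
    then have "?u * r - y * (v * r) \<in> adjoin Q y" using r(2) is_idealD(8)[OF Q'] by blast
    then have "evaluate t c' ys * r \<in> adjoin Q y" by (simp add: algebra_simps)
    then show "r \<in> adjoin Q y" using nonzerodivD[OF IH r(1)] by simp
  qed
  then have "nonzerodiv Q ?u"
    by (rule nonzerodiv_swap[OF Cons.prems(1) y(1) uR(2) ny])
  then show ?case unfolding *(1) using y uR ny by (intro nonzerodiv_mult nonzerodiv_power) auto
qed

text \<open>A nontrivial relation modulo \<open>p\<close> would be an element of \<open>p\<close>
  that is a nonzerodivisor modulo \<open>Q\<close>.\<close>

lemma algebraically_independent_prime:
  assumes "hom_ideal Q" "\<forall>y\<in>set ys. is_form y" "regseq Q ys"
    and p: "is_prime p" "\<And>x. x \<in> p \<Longrightarrow> \<not> nonzerodiv Q x"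
  shows "algebraically_independent p ys"
  unfolding algebraically_independent_def
proof (intro allI impI ballI, rule ccontr)
  fix t c \<alpha> assume "evaluate t c ys \<in> p" and *: "\<alpha> \<in> exponents t (length ys)" "c \<alpha> \<noteq> 0"
  then show False using evaluate_nonzerodiv[where c = c, OF assms(1-3) *] p(2) by blast
qed

section \<open>Counting monomials with bounded exponents\<close>

definition exponent_bound :: "nat \<Rightarrow> 'k mpol \<Rightarrow> bool" where
  "exponent_bound D p \<longleftrightarrow> (\<forall>t\<in>Poly_Mapping.keys p. \<forall>i. Poly_Mapping.lookup t i \<le> D)"

lemma exponent_bound_mult:
  assumes "exponent_bound D p" "exponent_bound D' q"
  shows "exponent_bound (D + D') (p * q)"
  unfolding exponent_bound_def
proof (intro ballI allI)
  fix t i assume "t \<in> Poly_Mapping.keys (p * q)"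
  then obtain u v where "t = u + v" "u \<in> Poly_Mapping.keys p" "v \<in> Poly_Mapping.keys q"
    using keys_mult[of p q] by blast
  then show "Poly_Mapping.lookup t i \<le> D + D'"
    using assms by (simp add: exponent_bound_def lookup_add add_mono)
qed

lemma exponent_bound_power: "exponent_bound D p \<Longrightarrow> exponent_bound (k * D) (p ^ k)"
proof (induction k)
  case 0
  then show ?case by (simp add: exponent_bound_def)
next
  case (Suc k)
  then show ?case using exponent_bound_mult[of D p "k * D" "p ^ k"] by simp
qed

lemma exponent_bound_mono: "exponent_bound D p \<Longrightarrow> D \<le> D' \<Longrightarrow> exponent_bound D' p"
  unfolding exponent_bound_def using order_trans by blast

lemma exists_exponent_bound: "\<exists>D. exponent_bound D p"
proof -
  let ?A = "\<Union>t\<in>Poly_Mapping.keys p. Poly_Mapping.range t"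
  have "Poly_Mapping.lookup t i \<le> Max (insert 0 ?A)" if "t \<in> Poly_Mapping.keys p" for t i
  proof (cases "i \<in> Poly_Mapping.keys t")
    case True
    then have "Poly_Mapping.lookup t i \<in> insert 0 ?A" 
      by (intro insertI2 UN_I[OF that] in_keys_lookup_in_range True)
    then show ?thesis by (intro Max_ge) auto
  next
    case False
    then show ?thesis by (simp add: in_keys_iff)
  qed
  then show ?thesis unfolding exponent_bound_def by blast
qed

lemma exists_exponent_bound_list: "\<exists>D. \<forall>z\<in>set zs. exponent_bound D z"
proof (induction zs)
  case (Cons z zs)
  then obtain D D' where "\<forall>z\<in>set zs. exponent_bound D z" "exponent_bound D' z"
    using exists_exponent_bound by blast
  then have "\<forall>x\<in>set (z # zs). exponent_bound (max D D') x"
    using exponent_bound_mono[of _ _ "max D D'"] by auto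
  then show ?case by blast
qed simp

lemma exponent_bound_monomial:
  assumes "\<forall>z\<in>set zs. exponent_bound D z" "\<alpha> \<in> exponents t (length zs)"
  shows "exponent_bound (length zs * (t * D)) (monomial zs \<alpha>)"
  using assms
proof (induction zs arbitrary: \<alpha>)
  case Nil
  then show ?case by (simp add: exponent_bound_def)
next
  case (Cons z zs)
  then obtain i \<beta> where \<alpha>: "\<alpha> = i # \<beta>" "i \<le> t" "\<beta> \<in> exponents t (length zs)"
    by (auto simp: exponents_Suc)
  have "exponent_bound (t * D) (z ^ i)"
    using exponent_bound_power[of D z i] Cons.prems(1) \<alpha>(2) by (auto intro: exponent_bound_mono)
  then show ?case using exponent_bound_mult[of "t * D" "z ^ i"] Cons \<alpha> by simp
qed

definition box :: "nat \<Rightarrow> (nat \<Rightarrow>\<^sub>0 nat) set" where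
  "box D = {t. Poly_Mapping.keys t \<subseteq> {..n} \<and> (\<forall>i. Poly_Mapping.lookup t i \<le> D)}"

lemma finite_box: "finite (box D)" and card_box: "card (box D) \<le> Suc D ^ Suc n"
proof -
  let ?f = "\<lambda>t :: nat \<Rightarrow>\<^sub>0 nat. restrict (Poly_Mapping.lookup t) {..n}"
  have inj: "inj_on ?f (box D)"
  proof (rule inj_onI)
    fix s t assume st: "s \<in> box D" "t \<in> box D" "?f s = ?f t"
    show "s = t"
    proof (rule poly_mapping_eqI)
      fix i
      show "Poly_Mapping.lookup s i = Poly_Mapping.lookup t i"
      proof (cases "i \<le> n")
        case True
        then show ?thesis using fun_cong[OF st(3), of i] by simp
      next
        case False
        then have "i \<notin> Poly_Mapping.keys s" "i \<notin> Poly_Mapping.keys t" using st by (auto simp: box_def)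
        then show ?thesis by (simp add: in_keys_iff)
      qed
    qed
  qed
  have sub: "?f ` box D \<subseteq> {..n} \<rightarrow>\<^sub>E {..D}"
    by (auto simp: box_def PiE_def extensional_def)
  have fin: "finite ({..n} \<rightarrow>\<^sub>E {..D})" by (intro finite_PiE) auto
  show "finite (box D)" using finite_imageD[OF finite_subset[OF sub fin] inj] .
  have "card (box D) \<le> card ({..n} \<rightarrow>\<^sub>E {..D})" by (rule card_inj_on_le[OF inj sub fin])
  then show "card (box D) \<le> Suc D ^ Suc n" by (simp add: card_PiE)
qed

text \<open>A dimension count: independence would make the (t+1)^(n+2) products with exponents up to
  \<open>t\<close> linearly independent, yet they all lie in the span of the monomials with
  exponents at most B = (n+2) t D, of which there are at most (B+1)^(n+1).\<close>

lemma not_algebraically_independent: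
  assumes zs: "set zs \<subseteq> carrier R" "length zs = n + 2"
  shows "\<not> algebraically_independent {0} zs"
proof
  assume indep: "algebraically_independent {0} zs"
  define scale :: "'k \<Rightarrow> 'k mpol \<Rightarrow> 'k mpol" where "scale = (\<lambda>c p. Poly_Mapping.single 0 c * p)"
  interpret V: vector_space scale
    by unfold_locales
      (simp_all add: scale_def distrib_left distrib_right single_add mult_single flip: mult.assoc)
  obtain D where D: "\<forall>z\<in>set zs. exponent_bound D z" using exists_exponent_bound_list by blast
  \<comment> \<open>These choices give B + 1 \<le> N (t+1) and (N (t+1))^(n+1) = t (t+1)^(n+1),
    which is smaller than (t+1)^(n+2).\<close>
  define N where "N = Suc ((n + 2) * D)"
  define t where "t = N ^ Suc n"
  let ?E = "exponents t (n + 2)" and ?B = "(n + 2) * (t * D)"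
  have coeff: "c \<alpha> = 0" if "(\<Sum>\<alpha>\<in>?E. scale (c \<alpha>) (monomial zs \<alpha>)) = 0" "\<alpha> \<in> ?E" for c \<alpha>
  proof -
    have "evaluate t c zs \<in> {0}" using that(1) zs(2) by (simp add: evaluate_def scale_def)
    then show ?thesis using indep that(2) zs(2) unfolding algebraically_independent_def by metis
  qed
  have inj: "inj_on (monomial zs) ?E"
  proof (rule inj_onI, rule ccontr)
    fix \<alpha> \<beta> assume *: "\<alpha> \<in> ?E" "\<beta> \<in> ?E" "monomial zs \<alpha> = monomial zs \<beta>" "\<alpha> \<noteq> \<beta>"
    \<comment> \<open>Two exponent vectors with the same product would give a relation whose
      coefficients are the difference of their indicator functions.\<close>
    let ?c = "\<lambda>\<gamma>. (if \<gamma> = \<alpha> then 1 else 0) - (if \<gamma> = \<beta> then 1 else 0) :: 'k"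
    have "(\<Sum>\<gamma>\<in>?E. scale (?c \<gamma>) (monomial zs \<gamma>)) =
        (\<Sum>\<gamma>\<in>?E. (if \<gamma> = \<alpha> then monomial zs \<gamma> else 0) - (if \<gamma> = \<beta> then monomial zs \<gamma> else 0))"
      by (intro sum.cong) (auto simp: scale_def single_uminus)
    also have "\<dots> = 0" using * finite_exponents[of t "n + 2"] by (simp add: sum_subtractf)
    finally have "?c \<alpha> = 0" using coeff[of ?c \<alpha>] *(1) by blast
    then show False using *(4) by simp
  qed
  have ind: "V.independent (monomial zs ` ?E)"
  proof (rule V.independent_if_scalars_zero)
    show "finite (monomial zs ` ?E)" using finite_exponents by blast
    fix f x
    assume f: "(\<Sum>x\<in>monomial zs ` ?E. scale (f x) x) = 0" and x: "x \<in> monomial zs ` ?E"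
    obtain \<alpha> where \<alpha>: "\<alpha> \<in> ?E" "x = monomial zs \<alpha>" using x by blast
    have "(\<Sum>\<alpha>\<in>?E. scale (f (monomial zs \<alpha>)) (monomial zs \<alpha>)) = 0"
      using f unfolding sum.reindex[OF inj] comp_def .
    then show "f x = 0" using coeff[of "\<lambda>\<alpha>. f (monomial zs \<alpha>)"] \<alpha> by blast
  qed
  let ?S = "(\<lambda>u. Poly_Mapping.single u (1 :: 'k)) ` box ?B"
  have span: "monomial zs ` ?E \<subseteq> V.span ?S"
  proof
    fix x assume "x \<in> monomial zs ` ?E"
    then obtain \<alpha> where \<alpha>: "\<alpha> \<in> ?E" "x = monomial zs \<alpha>" by blast
    have xb: "Poly_Mapping.keys x \<subseteq> box ?B"
      using exponent_bound_monomial[OF D, of \<alpha> t] monomial_mem[OF zs(1), of \<alpha>] \<alpha> zs(2)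
      by (auto simp: box_def exponent_bound_def carrier_R)
    have "x = (\<Sum>u\<in>Poly_Mapping.keys x. scale (Poly_Mapping.lookup x u) (Poly_Mapping.single u 1))"
      by (rule poly_mapping_eqI)
        (simp add: lookup_sum_poly scale_def mult_single lookup_single when_def in_keys_iff)
    also have "\<dots> \<in> V.span ?S"
      using xb by (intro V.span_sum V.span_scale V.span_base) auto
    finally show "x \<in> V.span ?S" .
  qed
  have "card ?E = card (monomial zs ` ?E)" using card_image[OF inj] by simp
  also have "\<dots> \<le> card ?S"
    using V.independent_span_bound[OF _ ind span] finite_box by blast
  also have "\<dots> \<le> card (box ?B)" using card_image_le[OF finite_box] by blast
  also have "\<dots> \<le> Suc ?B ^ Suc n" by (rule card_box)
  also have "\<dots> \<le> (N * Suc t) ^ Suc n"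
    by (intro power_mono) (simp_all add: N_def algebra_simps)
  also have "\<dots> = t * Suc t ^ Suc n" unfolding power_mult_distrib t_def ..
  finally have "Suc t * Suc t ^ Suc n \<le> t * Suc t ^ Suc n"
    by (simp add: card_exponents)
  then show False by simp
qed

text \<open>A prime containing the colon ideal \<open>Q : r\<close> and consisting of zero divisors modulo \<open>Q\<close> is minimal over
  \<open>(xs, f)\<close>: a smaller prime would produce \<open>n + 2\<close> algebraically independent elements.\<close>

lemma unmixed:
  assumes forms: "\<forall>x\<in>set (xs @ f # ys). is_form x"
    and reg: "regseq {0} (xs @ f # ys)" and len: "length (xs @ f # ys) = n + 1"
    and M: "M > 0" and r: "r \<in> carrier R"
    and loc: "\<And>p. minimal_over (adjoin_list {0} (xs @ [f])) p \<Longrightarrow>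
      \<exists>t\<in>carrier R - p. t * r \<in> adjoin_list {0} (xs @ [f ^ M])"
  shows "r \<in> adjoin_list {0} (xs @ [f ^ M])"
proof (rule ccontr)
  define Q where "Q = adjoin_list {0} (xs @ [f ^ M])"
  define J where "J = adjoin_list {0} (xs @ [f])"
  assume "r \<notin> adjoin_list {0} (xs @ [f ^ M])"
  then have rQ: "r \<notin> Q" by (simp add: Q_def)
  have mems: "set (xs @ f # ys) \<subseteq> carrier R" using forms is_form_mem by blast
  have fM: "is_form (f ^ M)" using forms M is_form_power by simp
  have hQ: "hom_ideal Q"
    unfolding Q_def using forms fM by (intro hom_ideal_adjoin_list hom_ideal_zero) auto
  then have Q: "is_ideal Q" by (rule hom_ideal_is_ideal)
  have J: "is_ideal J" unfolding J_def using mems by (intro is_ideal_adjoin_list is_ideal_zero) auto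
  have "regseq {0} (xs @ f ^ M # ys)" by (rule regseq_power[OF hom_ideal_zero forms reg M])
  then have regQ: "regseq Q ys" by (simp add: regseq_append Q_def)
  have regJ: "regseq {0} (xs @ [f])" using reg by (simp add: regseq_append)
  define colon where "colon = {t \<in> carrier R. t * r \<in> Q}"
  \<comment> \<open>\<open>S\<close> is closed under products, and it misses the colon ideal because
    cancelling an element of \<open>S\<close> from t r in \<open>Q\<close> would put
    \<open>r\<close> into \<open>Q\<close>.\<close>
  define S where "S = {t \<in> carrier R. nonzerodiv Q t}"
  have ic: "is_ideal colon"
    unfolding is_ideal_def colon_def
    using is_idealD[OF Q] r by (auto simp: distrib_right mult.assoc)
  have "colon \<inter> S = {}"
    using rQ r by (auto simp: colon_def S_def nonzerodiv_def)
  then obtain p where p: "is_prime p" "colon \<subseteq> p" "p \<inter> S = {}"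
    using exists_prime_disjoint[OF ic, of S] nonzerodiv_one nonzerodiv_mult
    unfolding S_def by auto
  have pI: "is_ideal p" using p(1) by (rule is_primeD)
  have Qp: "Q \<subseteq> p" using p(2) is_idealD(5,6)[OF Q] r by (auto simp: colon_def)
  have "set (xs @ [f ^ M]) \<subseteq> Q"
    unfolding Q_def using adjoin_list_mem[OF is_ideal_zero, of "xs @ [f ^ M]"] mems by auto
  then have "set xs \<subseteq> p" "f \<in> p"
    using Qp is_prime_power[OF p(1), of f M] mems by auto
  then have Jp: "J \<subseteq> p"
    unfolding J_def using is_idealD(2)[OF pI] by (intro adjoin_list_least pI) auto
  \<comment> \<open>\<open>ys\<close> is a regular sequence modulo \<open>Q\<close>, and
    \<open>p\<close>, which misses \<open>S\<close>, consists of zero divisors modulo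
    \<open>Q\<close>.\<close>
  have ys: "algebraically_independent p ys"
    using algebraically_independent_prime[OF hQ _ regQ p(1)] forms p(3) is_idealD(6)[OF pI]
    by (auto simp: S_def)
  have "q = p" if q: "is_prime q" "J \<subseteq> q" "q \<subseteq> p" for q
  proof (rule ccontr)
    assume "q \<noteq> p"
    then obtain x where x: "x \<in> p" "x \<notin> q" using q(3) by blast
    have xR: "x \<in> carrier R" using x(1) is_idealD(6)[OF pI] by blast
    have "adjoin q x \<subseteq> p" using q(3) x(1) pI by (intro adjoin_least)
    \<comment> \<open>An element of \<open>p\<close> outside the prime \<open>q\<close> is a
      nonzerodivisor modulo \<open>q\<close>, so it adds one more independent element to
      \<open>ys\<close>.\<close>
    then have "algebraically_independent q (x # ys)"
      using algebraically_independent_Cons[OF is_primeD(1)[OF q(1)], of x ys]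
        is_prime_nonzerodiv[OF q(1) xR x(2)] algebraically_independent_antimono[OF ys] xR mems by auto
    then have "algebraically_independent J (x # ys)"
      using q(2) algebraically_independent_antimono by blast
    then have "algebraically_independent {0} ((xs @ [f]) @ x # ys)"
      using xR mems by (intro algebraically_independent_regseq[OF is_ideal_zero _ regJ]) (auto simp: J_def)
    moreover have "\<not> algebraically_independent {0} ((xs @ [f]) @ x # ys)"
      using xR mems len by (intro not_algebraically_independent) auto
    ultimately show False by blast
  qed
  then have "minimal_over J p" using p(1) Jp by (simp add: minimal_over_def)
  \<comment> \<open>Minimality makes the local hypothesis available at \<open>p\<close>: its
    multiplier \<open>t\<close> belongs to the colon ideal, hence to \<open>p\<close>, which is
    absurd.\<close>
  then obtain t where "t \<in> carrier R - p" "t * r \<in> Q" using loc by (auto simp: J_def Q_def)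
  then show False using p(2) by (auto simp: colon_def)
qed

end

section \<open>Localization and symbolic powers\<close>

context poly_vars
begin

section \<open>Ideals of the polynomial ring in the two encodings\<close>

lemma ideal_iff_is_ideal: "ideal J R \<longleftrightarrow> is_ideal J"
proof
  assume "ideal J R"
  then interpret J: ideal J R .
  show "is_ideal J"
    unfolding is_ideal_def
  proof (intro conjI ballI)
    show "J \<subseteq> carrier R" by (rule J.a_subset)
    show "0 \<in> J" using additive_subgroup.zero_closed[OF J.additive_subgroup_axioms] by (simp only: zero_R)
    show "x + y \<in> J" if "x \<in> J" "y \<in> J" for x y
      using additive_subgroup.a_closed[OF J.additive_subgroup_axioms that] by (simp only: add_R)
    show "r * x \<in> J" if "r \<in> carrier R" "x \<in> J" for r x
      using J.I_l_closed[OF that(2,1)] by (simp only: mult_R)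
  qed
next
  interpret R: cring R by (rule cring_R)
  assume J: "is_ideal J"
  have minus: "\<ominus>\<^bsub>R\<^esub> x = - x" if "x \<in> carrier R" for x
    using that by (intro R.minus_equality) (auto simp: add_R zero_R)
  show "ideal J R"
  proof (rule idealI)
    show "ring R" by (rule R.ring_axioms)
    show "subgroup J (add_monoid R)"
    proof (rule R.add.subgroupI)
      show "J \<subseteq> carrier R" "J \<noteq> {}" using is_idealD(1,2)[OF J] by auto
      show "\<ominus>\<^bsub>R\<^esub> x \<in> J" if "x \<in> J" for x
        using that minus is_idealD(6,7)[OF J] by simp
      show "x \<oplus>\<^bsub>R\<^esub> y \<in> J" if "x \<in> J" "y \<in> J" for x y
        using that is_idealD(3)[OF J] by (simp add: add_R)
    qed
  qed (use is_idealD(4,5)[OF J] in \<open>auto simp: mult_R\<close>)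
qed

lemma primeideal_iff_is_prime: "primeideal p R \<longleftrightarrow> is_prime p"
proof
  assume "primeideal p R"
  then interpret p: primeideal p R .
  have "1 \<notin> p" using p.one_imp_carrier p.I_notcarr by (auto simp: one_R)
  then show "is_prime p"
    unfolding is_prime_def using ideal_iff_is_ideal p.ideal_axioms p.I_prime by (auto simp: mult_R)
next
  assume p: "is_prime p"
  show "primeideal p R"
  proof (rule primeidealI)
    show "ideal p R" using is_primeD(1)[OF p] by (simp add: ideal_iff_is_ideal)
    show "cring R" by (rule cring_R)
    show "carrier R \<noteq> p" using is_primeD(2)[OF p] one_mem by blast
    show "x \<in> p \<or> y \<in> p" if "x \<in> carrier R" "y \<in> carrier R" "x \<otimes>\<^bsub>R\<^esub> y \<in> p" for x y
      using is_primeD(3)[OF p] that by (simp add: mult_R)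
  qed
qed

lemma minimal_primes_iff: "p \<in> minimal_primes R J \<longleftrightarrow> minimal_over J p"
  by (simp add: minimal_primes_def minimal_over_def primeideal_iff_is_prime)

lemma is_ideal_genideal: "S \<subseteq> carrier R \<Longrightarrow> is_ideal (genideal R S)"
  using cring.axioms(1)[OF cring_R] ring.genideal_ideal ideal_iff_is_ideal by blast

lemma genideal_superset: "S \<subseteq> carrier R \<Longrightarrow> S \<subseteq> genideal R S"
  using cring.axioms(1)[OF cring_R] ring.genideal_self by blast

lemma genideal_least: "is_ideal L \<Longrightarrow> S \<subseteq> L \<Longrightarrow> genideal R S \<subseteq> L"
  using cring.axioms(1)[OF cring_R] ring.genideal_minimal ideal_iff_is_ideal by blast

text \<open>Bilinearity in two steps: for fixed factors on one side, the elements whose products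
  with them fall into \<open>L\<close> form an ideal, so the condition passes from generators to the
  generated ideal on each side in turn.\<close>

lemma genideal_mult:
  assumes L: "is_ideal L" and AB: "A \<subseteq> carrier R" "B \<subseteq> carrier R"
    and prods: "\<And>a b. a \<in> A \<Longrightarrow> b \<in> B \<Longrightarrow> a * b \<in> L"
    and xy: "x \<in> genideal R A" "y \<in> genideal R B"
  shows "x * y \<in> L"
proof -
  have colon: "is_ideal {x \<in> carrier R. \<forall>b\<in>S. x * b \<in> L}" for S
    unfolding is_ideal_def using is_idealD[OF L] by (auto simp: distrib_right mult.assoc)
  have "genideal R A \<subseteq> {x \<in> carrier R. \<forall>b\<in>B. x * b \<in> L}"
    using AB prods by (intro genideal_least colon) auto
  then have "B \<subseteq> {y \<in> carrier R. \<forall>b\<in>{x}. y * b \<in> L}" using xy AB by (auto simp: mult.commute)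
  then have "genideal R B \<subseteq> {y \<in> carrier R. \<forall>b\<in>{x}. y * b \<in> L}"
    by (intro genideal_least colon)
  then show ?thesis using xy by (auto simp: mult.commute)
qed

lemma genideal_set:
  assumes "set xs \<subseteq> carrier R"
  shows "genideal R (set xs) = adjoin_list {0} xs"
proof
  have I: "is_ideal (adjoin_list {0} xs)" using assms by (intro is_ideal_adjoin_list is_ideal_zero)
  show "genideal R (set xs) \<subseteq> adjoin_list {0} xs"
    using adjoin_list_mem[OF is_ideal_zero assms] by (intro genideal_least I) auto
  show "adjoin_list {0} xs \<subseteq> genideal R (set xs)"
    using is_idealD(2)[OF is_ideal_genideal[OF assms]] genideal_superset[OF assms]
    by (intro adjoin_list_least is_ideal_genideal assms) auto
qed

lemma regular_sequence_imp_regseq: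
  assumes "regular_sequence R fs"
  shows "regseq {0} fs"
proof -
  have fs: "set fs \<subseteq> carrier R"
    and reg: "\<And>i. i < length fs \<Longrightarrow> nonzerodiv (genideal R (set (take i fs))) (fs ! i)"
    using assms by (auto simp: regular_sequence_def nonzerodiv_def mult_R)
  have "regseq {0} (take k fs)" if "k \<le> length fs" for k
    using that
  proof (induction k)
    case (Suc k)
    moreover have "set (take k fs) \<subseteq> carrier R" using fs set_take_subset by fast
    ultimately show ?case
      using reg[of k] by (simp add: take_Suc_conv_app_nth regseq_append genideal_set)
  qed simp
  from this[of "length fs"] show ?thesis by simp
qed

section \<open>Products, powers and symbolic powers of ideals\<close>

lemma is_ideal_ideal_prod: "is_ideal A \<Longrightarrow> is_ideal B \<Longrightarrow> is_ideal (ideal_prod R A B)"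
  using cring.axioms(1)[OF cring_R] ring.ideal_prod_is_ideal ideal_iff_is_ideal by blast

lemma ideal_prod_memI: "x \<in> A \<Longrightarrow> y \<in> B \<Longrightarrow> x * y \<in> ideal_prod R A B"
  using ideal_prod.prod[of x A y B R] by (simp add: mult_R)

lemma ideal_prod_least:
  assumes L: "is_ideal L" and prods: "\<And>x y. x \<in> A \<Longrightarrow> y \<in> B \<Longrightarrow> x * y \<in> L"
  shows "ideal_prod R A B \<subseteq> L"
proof
  fix z assume "z \<in> ideal_prod R A B"
  then show "z \<in> L"
    by induction (use prods is_idealD(3)[OF L] in \<open>auto simp: mult_R add_R\<close>)
qed

lemma ideal_power_0: "ideal_power R J 0 = carrier R"
  by (simp add: ideals_set_def)

lemma ideal_power_Suc: "ideal_power R J (Suc m) = ideal_prod R (ideal_power R J m) J"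
  by (simp add: ideals_set_def)

lemma is_ideal_ideal_power: "is_ideal J \<Longrightarrow> is_ideal (ideal_power R J m)"
proof (induction m)
  case 0
  have "is_ideal (carrier R)" by (simp add: is_ideal_def)
  then show ?case by (simp only: ideal_power_0)
qed (simp only: ideal_power_Suc is_ideal_ideal_prod)

lemma power_in_ideal_power: "x \<in> J \<Longrightarrow> x ^ m \<in> ideal_power R J m"
proof (induction m)
  case 0
  then show ?case by (simp only: ideal_power_0 power_0 one_mem)
next
  case (Suc m)
  then show ?case by (simp only: ideal_power_Suc power_Suc2 ideal_prod_memI)
qed

text \<open>Membership in the extended ideal is reduced to clearing one denominator. In one
  direction t r is multiplied by the fraction 1/t; in the other, the extended ideal lies in the set
  \<open>E\<close> of fractions with numerator in \<open>J\<close>, and r/1 = x/t means t r = x in a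
  domain.\<close>

lemma extension_localization_iff:
  assumes p: "is_prime p" and J: "is_ideal J" and r: "r \<in> carrier R"
  shows "to_fract r \<in> extension_localization n p J \<longleftrightarrow> (\<exists>t\<in>carrier R - p. t * r \<in> J)"
proof -
  let ?L = "localization n p"
  interpret L: cring ?L
    by (rule cring_localization) (simp add: primeideal_iff_is_prime p)
  have carr: "carrier ?L = {Fract r t | r t. r \<in> carrier R \<and> t \<in> carrier R - p}"
    and mult: "x \<otimes>\<^bsub>?L\<^esub> y = x * y" and add: "x \<oplus>\<^bsub>?L\<^esub> y = x + y"
    and zero: "\<zero>\<^bsub>?L\<^esub> = 0" for x y
    by (simp_all add: localization_def ring_of_type_algebra_def)
  have one: "1 \<in> carrier R - p" using is_primeD(2)[OF p] by simp
  have nz: "t \<noteq> 0" if "t \<in> carrier R - p" for t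
    using that is_idealD(2)[OF is_primeD(1)[OF p]] by auto
  have prod: "t * u \<in> carrier R - p" if "t \<in> carrier R - p" "u \<in> carrier R - p" for t u
    using that is_primeD(3)[OF p, of t u] by auto
  have FractI: "Fract x t \<in> carrier ?L" if "x \<in> carrier R" "t \<in> carrier R - p" for x t
    using that unfolding carr by blast
  have sub: "to_fract ` J \<subseteq> carrier ?L"
    using is_idealD(1)[OF J] FractI[OF _ one] by (auto simp: to_fract_def)
  have ext: "ideal (extension_localization n p J) ?L"
    unfolding extension_localization_def using sub by (rule L.genideal_ideal)
  show ?thesis
  proof
    assume "\<exists>t\<in>carrier R - p. t * r \<in> J"
    then obtain t where t: "t \<in> carrier R - p" "t * r \<in> J" by blast
    have "to_fract (t * r) \<in> extension_localization n p J"
      unfolding extension_localization_def using L.genideal_self[OF sub] t(2) by blast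
    moreover have "Fract 1 t \<in> carrier ?L" using t by (intro FractI) auto
    ultimately have "Fract 1 t \<otimes>\<^bsub>?L\<^esub> to_fract (t * r) \<in> extension_localization n p J"
      using ideal.I_l_closed[OF ext] by blast
    moreover have "Fract 1 t * to_fract (t * r) = to_fract r"
      using nz[OF t(1)] by (simp add: to_fract_def eq_fract)
    ultimately show "to_fract r \<in> extension_localization n p J" by (simp only: mult)
  next
    define E where "E = {Fract x t | x t. x \<in> J \<and> t \<in> carrier R - p}"
    have EI: "Fract x t \<in> E" if "x \<in> J" "t \<in> carrier R - p" for x t using that unfolding E_def by blast
    have E_carr: "E \<subseteq> carrier ?L" using is_idealD(1)[OF J] FractI by (auto simp: E_def)
    have mE: "y * z \<in> E" if y: "y \<in> carrier ?L" and z: "z \<in> E" for y z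
    proof -
      obtain x t where "z = Fract x t" "x \<in> J" "t \<in> carrier R - p" using z by (auto simp: E_def)
      moreover obtain x' t' where "y = Fract x' t'" "x' \<in> carrier R" "t' \<in> carrier R - p"
        using y by (auto simp: carr)
      ultimately show ?thesis using prod is_idealD(4)[OF J] by (auto intro!: EI)
    qed
    have "ideal E ?L"
    proof (rule idealI)
      show "ring ?L" by (rule L.ring_axioms)
      show "subgroup E (add_monoid ?L)"
      proof (rule L.add.subgroupI)
        show "E \<subseteq> carrier ?L" by fact
        show "E \<noteq> {}" using EI[OF is_idealD(2)[OF J] one] by blast
        show "\<ominus>\<^bsub>?L\<^esub> y \<in> E" if y: "y \<in> E" for y
        proof -
          obtain x t where y: "y = Fract x t" "x \<in> J" "t \<in> carrier R - p" using y by (auto simp: E_def)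
          have yE: "- y \<in> E" unfolding y(1) minus_fract using y is_idealD(7)[OF J] by (intro EI) auto
          have "\<ominus>\<^bsub>?L\<^esub> y = - y"
            using yE \<open>y \<in> E\<close> E_carr by (intro L.minus_equality) (auto simp: add zero)
          then show ?thesis using yE by simp
        qed
        show "y \<oplus>\<^bsub>?L\<^esub> z \<in> E" if yz: "y \<in> E" "z \<in> E" for y z
        proof -
          obtain x t x' t' where *: "y = Fract x t" "x \<in> J" "t \<in> carrier R - p"
            "z = Fract x' t'" "x' \<in> J" "t' \<in> carrier R - p"
            using yz by (auto simp: E_def)
          have "y + z = Fract (x * t' + x' * t) (t * t')" using * nz by (simp add: add_fract)
          moreover have "x * t' + x' * t \<in> J" using * is_idealD(3,5)[OF J] by simp
          ultimately show ?thesis using EI prod * by (simp add: add)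
        qed
      qed
      show "y \<otimes>\<^bsub>?L\<^esub> z \<in> E" "z \<otimes>\<^bsub>?L\<^esub> y \<in> E" if "z \<in> E" "y \<in> carrier ?L" for y z
        using mE[OF that(2,1)] by (simp_all add: mult mult.commute)
    qed
    moreover have "to_fract ` J \<subseteq> E" using EI one by (auto simp: to_fract_def)
    ultimately have "extension_localization n p J \<subseteq> E"
      unfolding extension_localization_def by (rule L.genideal_minimal)
    moreover assume "to_fract r \<in> extension_localization n p J"
    ultimately obtain x t where *: "to_fract r = Fract x t" "x \<in> J" "t \<in> carrier R - p"
      by (auto simp: E_def)
    then have "t * r = x" using nz[OF *(3)] by (simp add: to_fract_def eq_fract mult.commute)
    then show "\<exists>t\<in>carrier R - p. t * r \<in> J" using * by blast
  qed
qed

text \<open>Removes localizations: from here on a symbolic power is handled through multipliers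
  outside each minimal prime.\<close>

lemma star_symbolic_power_iff:
  assumes "is_ideal J"
  shows "r \<in> star_symbolic_power n J m \<longleftrightarrow> r \<in> carrier R \<and>
    (\<forall>p. minimal_over J p \<longrightarrow> (\<exists>t\<in>carrier R - p. t * r \<in> ideal_power R J m))"
  using extension_localization_iff[OF _ is_ideal_ideal_power[OF assms]]
  by (auto simp: star_symbolic_power_def minimal_primes_iff minimal_over_def)

lemma is_ideal_star_symbolic_power:
  assumes J: "is_ideal J"
  shows "is_ideal (star_symbolic_power n J m)"
proof -
  let ?S = "star_symbolic_power n J m" and ?Q = "ideal_power R J m"
  have Q: "is_ideal ?Q" by (rule is_ideal_ideal_power[OF J])
  have one: "1 \<in> carrier R - p" if "minimal_over J p" for p
    using that by (auto simp: minimal_over_def is_prime_def)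
  show ?thesis
    unfolding is_ideal_def
  proof (intro conjI ballI)
    show "?S \<subseteq> carrier R" by (auto simp: star_symbolic_power_def)
    have "\<exists>t\<in>carrier R - p. t * 0 \<in> ?Q" if "minimal_over J p" for p
      using one[OF that] is_idealD(2)[OF Q] by (intro bexI[of _ 1]) auto
    then show "0 \<in> ?S" unfolding star_symbolic_power_iff[OF J] using zero_mem by blast
  next
    fix x y assume x: "x \<in> ?S" and y: "y \<in> ?S"
    show "x + y \<in> ?S"
      unfolding star_symbolic_power_iff[OF J]
    proof (intro conjI allI impI)
      show "x + y \<in> carrier R" using x y by (simp add: star_symbolic_power_def)
      fix p assume p: "minimal_over J p"
      obtain t u where *: "t \<in> carrier R - p" "t * x \<in> ?Q" "u \<in> carrier R - p" "u * y \<in> ?Q"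
        using x y p unfolding star_symbolic_power_iff[OF J] by blast
      have "(t * u) * (x + y) = u * (t * x) + t * (u * y)" by (simp add: algebra_simps)
      also have "\<dots> \<in> ?Q"
        using * is_idealD(4)[OF Q, of u "t * x"] is_idealD(4)[OF Q, of t "u * y"]
        by (intro is_idealD(3)[OF Q]) auto
      finally have "(t * u) * (x + y) \<in> ?Q" .
      moreover have "t * u \<in> carrier R - p"
        using * p is_primeD(3)[of p t u] by (auto simp: minimal_over_def)
      ultimately show "\<exists>t\<in>carrier R - p. t * (x + y) \<in> ?Q" by blast
    qed
  next
    fix r x assume r: "r \<in> carrier R" and x: "x \<in> ?S"
    show "r * x \<in> ?S"
      unfolding star_symbolic_power_iff[OF J]
    proof (intro conjI allI impI)
      show "r * x \<in> carrier R" using r x by (simp add: star_symbolic_power_def)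
      fix p assume p: "minimal_over J p"
      obtain t where *: "t \<in> carrier R - p" "t * x \<in> ?Q"
        using x p unfolding star_symbolic_power_iff[OF J] by blast
      have "t * (r * x) = r * (t * x)" by (simp add: algebra_simps)
      also have "\<dots> \<in> ?Q" using * r is_idealD(4)[OF Q] by blast
      finally show "\<exists>t\<in>carrier R - p. t * (r * x) \<in> ?Q" using * by blast
    qed
  qed
qed

end

section \<open>Fold products of generic forms\<close>

text \<open>Greedy choice: each index takes as much of the remaining total as its bound
  allows.\<close>

lemma exists_bounded_with_sum:
  fixes M :: "'i \<Rightarrow> nat"
  assumes "finite A" "k \<le> sum M A"
  shows "\<exists>\<alpha>. (\<forall>i. \<alpha> i \<le> M i) \<and> (\<forall>i. i \<notin> A \<longrightarrow> \<alpha> i = 0) \<and> sum \<alpha> A = k"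
  using assms
proof (induction A arbitrary: k)
  case empty
  then show ?case by (intro exI[of _ "\<lambda>_. 0"]) simp
next
  case (insert x A)
  have "k - min k (M x) \<le> sum M A" using insert by simp
  then obtain \<alpha> where \<alpha>: "\<forall>i. \<alpha> i \<le> M i" "\<forall>i. i \<notin> A \<longrightarrow> \<alpha> i = 0" "sum \<alpha> A = k - min k (M x)"
    using insert.IH by blast
  let ?\<beta> = "\<alpha>(x := min k (M x))"
  have "sum ?\<beta> A = sum \<alpha> A" using insert.hyps by (intro sum.cong) auto
  then have "sum ?\<beta> (insert x A) = k" using insert.hyps \<alpha>(3) by simp
  then show ?case using \<alpha> by (intro exI[of _ ?\<beta>]) auto
qed

text \<open>The remainder \<open>e\<close> of \<open>a\<close> is taken in 1..b instead of 0..b-1.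
  Hence exponents bounded by \<open>b\<close> with total \<open>a\<close> involve more than
  \<open>c\<close> forms, and so meet every subset of \<open>F\<close> of size
  \<open>h\<close>.\<close>

locale generic_forms = poly_vars n K for n :: nat and K :: "'k::field itself" +
  fixes F :: "'k mpol set" and a b c e h :: nat
  assumes finite_F: "finite F" and generic: "generic_set n F" and card_F: "card F = h + c"
    and h: "1 \<le> h" "h \<le> n" "n < h + c" and e: "1 \<le> e" "e \<le> b" and a: "a = b * c + e"
begin

abbreviation fold_ideal :: "'k mpol set" where
  "fold_ideal \<equiv> fold_product_ideal n a b F"

lemma is_form_F: "f \<in> F \<Longrightarrow> is_form f"
  using generic by (auto simp: generic_set_def is_form_def)

lemma F_subset: "F \<subseteq> carrier R"
  using is_form_F is_form_mem by blast

lemma F_mem: "f \<in> F \<Longrightarrow> f \<in> carrier R"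
  using F_subset by blast

lemma prod_F_mem: "A \<subseteq> F \<Longrightarrow> (\<Prod>f\<in>A. f ^ N f) \<in> carrier R"
  using F_mem by (intro prod_mem power_mem) auto

text \<open>Genericity supplies a regular sequence in some order; \<open>regseq_permute\<close>
  gives the prescribed one.\<close>

lemma regseq_F:
  assumes "distinct gs" "set gs \<subseteq> F" "length gs \<le> n + 1"
  shows "regseq {0} gs"
proof -
  have "card (set gs) \<le> n + 1" using assms distinct_card by metis
  then obtain fs where fs: "distinct fs" "set fs = set gs" "regular_sequence R fs"
    using generic assms(2) unfolding generic_set_def by (meson List.finite_set)
  show ?thesis
  proof (rule regseq_permute[OF hom_ideal_zero])
    show "\<forall>x\<in>set fs. is_form x" using fs(2) assms(2) is_form_F by auto
    show "regseq {0} fs" using fs(3) by (rule regular_sequence_imp_regseq)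
    show "mset fs = mset gs" using fs assms(1) set_eq_iff_mset_eq_distinct by blast
  qed
qed

lemma fold_gens_subset:
  "{\<Prod>f\<in>F. f ^ N f | N. (\<forall>f\<in>F. N f \<le> b) \<and> (\<Sum>f\<in>F. N f) = a} \<subseteq> carrier R"
  using prod_F_mem by auto

lemma is_ideal_fold: "is_ideal fold_ideal"
  unfolding fold_product_ideal_def by (rule is_ideal_genideal[OF fold_gens_subset])

lemma fold_memI:
  assumes "\<forall>f\<in>F. N f \<le> b" "(\<Sum>f\<in>F. N f) = a"
  shows "(\<Prod>f\<in>F. f ^ N f) \<in> fold_ideal"
  using genideal_superset[OF fold_gens_subset] assms unfolding fold_product_ideal_def by blast

lemma fold_least:
  assumes "is_ideal L" "\<And>N. \<forall>f\<in>F. N f \<le> b \<Longrightarrow> (\<Sum>f\<in>F. N f) = a \<Longrightarrow> (\<Prod>f\<in>F. f ^ N f) \<in> L"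
  shows "fold_ideal \<subseteq> L"
  unfolding fold_product_ideal_def using assms by (intro genideal_least) auto

section \<open>Minimal primes of the fold product ideal\<close>

lemma prod_mem_ideal:
  assumes "is_ideal L" "f \<in> F" "f ^ k \<in> L" "k \<le> N f"
  shows "(\<Prod>f\<in>F. f ^ N f) \<in> L"
proof (rule is_ideal_prod_mem[OF assms(1) finite_F _ assms(2)])
  have "f ^ N f = f ^ (N f - k) * f ^ k" using assms(4) by (simp flip: power_add)
  then show "f ^ N f \<in> L" using is_idealD(4)[OF assms(1) _ assms(3)] F_mem[OF assms(2)] by simp
qed (simp add: F_mem)

text \<open>At most \<open>c\<close> forms lie outside \<open>q\<close>, and together they carry
  weight at most b c < a; so every generator involves a form in \<open>q\<close>.\<close>

lemma fold_subset_prime: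
  assumes q: "is_prime q" and card: "card (F \<inter> q) \<ge> h"
  shows "fold_ideal \<subseteq> q"
proof (rule fold_least)
  show I: "is_ideal q" using q by (rule is_primeD)
  fix N assume N: "\<forall>f\<in>F. N f \<le> b" "(\<Sum>f\<in>F. N f) = a"
  have "\<exists>f\<in>F \<inter> q. N f > 0"
  proof (rule ccontr)
    assume "\<not> ?thesis"
    then have "(\<Sum>f\<in>F. N f) = (\<Sum>f\<in>F - q. N f)"
      using finite_F by (intro sum.mono_neutral_right) auto
    also have "\<dots> \<le> card (F - q) * b" using N(1) sum_bounded_above[of "F - q" N b] by simp
    also have "card (F - q) = card F - card (F \<inter> q)"
      using finite_F by (simp add: card_Diff_subset_Int)
    also have "(card F - card (F \<inter> q)) * b \<le> c * b" using card card_F by (intro mult_right_mono) auto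
    finally show False using N(2) a e by (simp add: mult.commute)
  qed
  then obtain f where "f \<in> F" "f \<in> q" "N f \<ge> 1" by auto
  then show "(\<Prod>f\<in>F. f ^ N f) \<in> q" using prod_mem_ideal[OF I, of f 1 N] by simp
qed

text \<open>Otherwise at least c + 1 forms lie outside \<open>p\<close>. Since b (c+1) \<ge> a, some
  generator is a product of these alone and cannot belong to \<open>p\<close>.\<close>

lemma card_prime:
  assumes p: "is_prime p" and sub: "fold_ideal \<subseteq> p"
  shows "card (F \<inter> p) \<ge> h"
proof (rule ccontr)
  assume "\<not> ?thesis"
  moreover have "card (F - p) = card F - card (F \<inter> p)"
    using finite_F by (simp add: card_Diff_subset_Int)
  ultimately have "c + 1 \<le> card (F - p)" using card_F by simp
  then have "b * (c + 1) \<le> b * card (F - p)" by (rule mult_le_mono2)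
  then have "a \<le> (\<Sum>f\<in>F - p. b)" using a e by (simp add: mult.commute)
  then obtain N where N: "\<forall>f. N f \<le> b" "\<forall>f. f \<notin> F - p \<longrightarrow> N f = 0" "sum N (F - p) = a"
    using exists_bounded_with_sum[of "F - p" a "\<lambda>_. b"] finite_F by auto
  have "sum N F = sum N (F - p)"
    using N(2) finite_F by (intro sum.mono_neutral_right) auto
  then have "(\<Prod>f\<in>F. f ^ N f) \<in> p" using sub fold_memI[of N] N by auto
  then obtain f where f: "f \<in> F" "f ^ N f \<in> p"
    using is_prime_prod[OF p finite_F, of "\<lambda>f. f ^ N f"] F_mem by auto
  then have "f \<in> p" using is_prime_power[OF p] F_mem by blast
  then show False using f N(2) is_primeD(2)[OF p] by simp
qed

text \<open>Suppose \<open>p\<close> contains h + 1 \<le> n + 1 forms, namely \<open>us\<close> and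
  \<open>g\<close>. A prime between the ideal of \<open>us\<close> and \<open>p\<close> contains
  \<open>h\<close> forms, hence \<open>fold_ideal\<close>, hence equals \<open>p\<close>. So
  \<open>p\<close> is minimal over the ideal of \<open>us\<close>, while \<open>g\<close> is a
  nonzerodivisor modulo it.\<close>

lemma card_minimal_prime:
  assumes p: "minimal_over fold_ideal p"
  shows "card (F \<inter> p) = h"
proof (rule ccontr)
  have pp: "is_prime p" and sub: "fold_ideal \<subseteq> p"
    and pmin: "\<And>q. is_prime q \<Longrightarrow> fold_ideal \<subseteq> q \<Longrightarrow> q \<subseteq> p \<Longrightarrow> q = p"
    using p by (auto simp: minimal_over_def)
  assume "card (F \<inter> p) \<noteq> h"
  then have "Suc h \<le> card (F \<inter> p)" using card_prime[OF pp sub] by simp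
  then obtain G where G: "G \<subseteq> F \<inter> p" "card G = Suc h" "finite G" by (rule obtain_subset_with_card_n)
  obtain gs where gs: "set gs = G" "distinct gs" using finite_distinct_list[OF G(3)] by blast
  then have len: "length gs = Suc h" using G(2) distinct_card[of gs] by simp
  then obtain us g where us: "gs = us @ [g]" by (metis append_butlast_last_id list.size(3) nat.distinct(1))
  have mem: "set us \<subseteq> F \<inter> p" "g \<in> F" "g \<in> p" "distinct us" "length us = h"
    using us gs G(1) len by auto
  have usR: "set us \<subseteq> carrier R" using mem(1) F_subset by blast
  have J: "is_ideal (adjoin_list {0} us)" by (intro is_ideal_adjoin_list is_ideal_zero usR)
  have "regseq {0} (us @ [g])"
    using gs us G len h by (intro regseq_F) auto
  then have nz: "nonzerodiv (adjoin_list {0} us) g" by (simp add: regseq_append)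
  have "minimal_over (adjoin_list {0} us) p"
    unfolding minimal_over_def
  proof (intro conjI allI impI)
    show "adjoin_list {0} us \<subseteq> p"
      using mem(1) is_idealD(2)[OF is_primeD(1)[OF pp]]
      by (intro adjoin_list_least is_primeD(1)[OF pp]) auto
    fix q assume q: "is_prime q \<and> adjoin_list {0} us \<subseteq> q \<and> q \<subseteq> p"
    then have "set us \<subseteq> F \<inter> q" using adjoin_list_mem[OF is_ideal_zero usR] mem(1) by blast
    then have "card (set us) \<le> card (F \<inter> q)" using finite_F by (intro card_mono) auto
    then have "h \<le> card (F \<inter> q)" using mem distinct_card[of us] by simp
    then show "q = p" using pmin q fold_subset_prime by blast
  qed (rule pp)
  then show False using minimal_over_not_mem[OF J _ F_mem nz] mem by blast
qed

text \<open>Any further form of \<open>F\<close> is a nonzerodivisor modulo \<open>us\<close>, so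
  \<open>p\<close> contains no form of \<open>F\<close> besides \<open>us\<close>. A prime between
  \<open>fold_ideal\<close> and \<open>p\<close> contains at least \<open>h\<close> forms, which
  must therefore be all of \<open>us\<close>.\<close>

lemma minimal_over_fold_ideal:
  assumes us: "distinct us" "set us \<subseteq> F" "length us = h"
    and p: "minimal_over (adjoin_list {0} us) p"
  shows "minimal_over fold_ideal p"
proof -
  have pp: "is_prime p" and sub: "adjoin_list {0} us \<subseteq> p"
    and pmin: "\<And>q. is_prime q \<Longrightarrow> adjoin_list {0} us \<subseteq> q \<Longrightarrow> q \<subseteq> p \<Longrightarrow> q = p"
    using p by (auto simp: minimal_over_def)
  have usR: "set us \<subseteq> carrier R" using us(2) F_subset by blast
  have J: "is_ideal (adjoin_list {0} us)" by (intro is_ideal_adjoin_list is_ideal_zero usR)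
  have usp: "set us \<subseteq> F \<inter> p" using us(2) adjoin_list_mem[OF is_ideal_zero usR] sub by blast
  have "F \<inter> p \<subseteq> set us"
  proof
    fix g assume g: "g \<in> F \<inter> p"
    show "g \<in> set us"
    proof (rule ccontr)
      assume "g \<notin> set us"
      then have "regseq {0} (us @ [g])" using us g h by (intro regseq_F) auto
      then have "nonzerodiv (adjoin_list {0} us) g" by (simp add: regseq_append)
      then show False using minimal_over_not_mem[OF J p F_mem] g by blast
    qed
  qed
  then have eq: "F \<inter> p = set us" using usp by blast
  have card_us: "card (set us) = h" using us distinct_card by metis
  show ?thesis
    unfolding minimal_over_def
  proof (intro conjI allI impI)
    show "fold_ideal \<subseteq> p" using fold_subset_prime[OF pp] eq card_us by simp
    fix q assume q: "is_prime q \<and> fold_ideal \<subseteq> q \<and> q \<subseteq> p"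
    then have "F \<inter> q \<subseteq> set us" using eq by blast
    moreover have "h \<le> card (F \<inter> q)" using card_prime q by blast
    ultimately have "F \<inter> q = set us" using card_us by (intro card_seteq) auto
    then have "adjoin_list {0} us \<subseteq> q"
      using q is_idealD(2)[OF is_primeD(1)] by (intro adjoin_list_least is_primeD(1)) auto
    then show "q = p" using pmin q by blast
  qed (rule pp)
qed

section \<open>Ordinary and symbolic powers of the fold product ideal\<close>

lemma fold_power_least:
  assumes L: "is_ideal L"
    and prods: "\<And>N. \<forall>f\<in>F. N f \<le> b * m \<Longrightarrow> (\<Sum>f\<in>F. N f) = a * m \<Longrightarrow> (\<Prod>f\<in>F. f ^ N f) \<in> L"
  shows "ideal_power R fold_ideal m \<subseteq> L"
proof -
  \<comment> \<open>Exponent vectors add under multiplication, so the bounds for \<open>G k\<close>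
    and \<open>G 1\<close> add up to those for \<open>G (Suc k)\<close>.\<close>
  define G where "G k = {\<Prod>f\<in>F. f ^ N f | N. (\<forall>f\<in>F. N f \<le> b * k) \<and> (\<Sum>f\<in>F. N f) = a * k}" for k
  have G: "G k \<subseteq> carrier R" for k using prod_F_mem by (auto simp: G_def)
  have fold: "fold_ideal = genideal R (G 1)" by (simp add: G_def fold_product_ideal_def)
  have GI: "is_ideal (genideal R (G k))" for k by (rule is_ideal_genideal[OF G])
  have "ideal_power R fold_ideal k \<subseteq> genideal R (G k)" for k
  proof (induction k)
    case 0
    have "(\<Prod>f\<in>F. f ^ 0) \<in> G 0" unfolding G_def by (intro CollectI exI[of _ "\<lambda>_. 0"]) simp
    then have "1 \<in> genideal R (G 0)" using genideal_superset[OF G, of 0] by auto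
    then have "x \<in> genideal R (G 0)" if "x \<in> carrier R" for x
      using is_idealD(4)[OF GI that, of 1] by simp
    then show ?case by (auto simp only: ideal_power_0)
  next
    case (Suc k)
    have GG: "x * y \<in> genideal R (G (Suc k))" if xy: "x \<in> G k" "y \<in> G 1" for x y
    proof -
      obtain N N' where N: "x = (\<Prod>f\<in>F. f ^ N f)" "\<forall>f\<in>F. N f \<le> b * k" "(\<Sum>f\<in>F. N f) = a * k"
        and N': "y = (\<Prod>f\<in>F. f ^ N' f)" "\<forall>f\<in>F. N' f \<le> b" "(\<Sum>f\<in>F. N' f) = a"
        using xy by (auto simp: G_def)
      have "x * y = (\<Prod>f\<in>F. f ^ (N f + N' f))" by (simp add: N N' power_add prod.distrib)
      moreover have "\<forall>f\<in>F. N f + N' f \<le> b * Suc k" using N N' by (auto simp: add_mono add.commute)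
      moreover have "(\<Sum>f\<in>F. N f + N' f) = a * Suc k" using N N' by (simp add: sum.distrib)
      ultimately have "x * y \<in> G (Suc k)"
        unfolding G_def by (intro CollectI exI[of _ "\<lambda>f. N f + N' f"]) simp
      then show ?thesis using genideal_superset[OF G] by blast
    qed
    show ?case
      unfolding ideal_power_Suc
    proof (rule ideal_prod_least[OF GI])
      fix x y assume "x \<in> ideal_power R fold_ideal k" "y \<in> fold_ideal"
      then have "x \<in> genideal R (G k)" "y \<in> genideal R (G 1)" using Suc fold by auto
      then show "x * y \<in> genideal R (G (Suc k))" using genideal_mult[OF GI G G GG] by blast
    qed
  qed
  moreover have "genideal R (G m) \<subseteq> L" using prods by (intro genideal_least L) (auto simp: G_def)
  ultimately show ?thesis by blast
qed

text \<open>In the application \<open>T\<close> consists of the forms in a minimal prime, and the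
  second factor is a unit there. One generator is split off per step: total exponent
  \<open>e\<close> on \<open>T\<close> and exponent \<open>b\<close> on each of the \<open>c\<close>
  other forms, which adds up to b c + e = a.\<close>

lemma prod_in_fold_power:
  assumes T: "T \<subseteq> F" "card T = h"
  shows "e * m \<le> sum M T \<Longrightarrow>
    (\<Prod>f\<in>T. f ^ M f) * (\<Prod>f\<in>F - T. f ^ b) ^ m \<in> ideal_power R fold_ideal m"
proof (induction m arbitrary: M)
  case 0
  have "(\<Prod>f\<in>T. f ^ M f) \<in> carrier R" using prod_F_mem[OF T(1)] .
  then show ?case unfolding ideal_power_0 by simp
next
  case (Suc m)
  have fT: "finite T" using T(1) finite_F finite_subset by blast
  have "e \<le> sum M T" using Suc.prems by simp
  then obtain \<alpha> where \<alpha>: "\<forall>f. \<alpha> f \<le> M f" "sum \<alpha> T = e"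
    using exists_bounded_with_sum[OF fT] by blast
  define N where "N f = (if f \<in> T then \<alpha> f else b)" for f
  have split: "F = T \<union> (F - T)" using T(1) by blast
  have card_co: "card (F - T) = c" using T card_F fT by (simp add: card_Diff_subset)
  have "\<alpha> f \<le> e" if "f \<in> T" for f using that fT \<alpha>(2) member_le_sum[of f T \<alpha>] by simp
  then have Nb: "\<forall>f\<in>F. N f \<le> b" using e by (auto simp: N_def intro: order_trans)
  have "(\<Sum>f\<in>F. N f) = (\<Sum>f\<in>T. N f) + (\<Sum>f\<in>F - T. N f)"
    by (subst split, rule sum.union_disjoint) (use fT finite_F in auto)
  also have "\<dots> = a" using \<alpha>(2) card_co a by (simp add: N_def mult.commute)
  finally have "(\<Prod>f\<in>F. f ^ N f) \<in> fold_ideal" by (intro fold_memI Nb)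
  moreover have "(\<Prod>f\<in>F. f ^ N f) = (\<Prod>f\<in>T. f ^ N f) * (\<Prod>f\<in>F - T. f ^ N f)"
    by (subst split, rule prod.union_disjoint) (use fT finite_F in auto)
  moreover have "\<dots> = (\<Prod>f\<in>T. f ^ \<alpha> f) * (\<Prod>f\<in>F - T. f ^ b)" by (simp add: N_def)
  ultimately have 1: "(\<Prod>f\<in>T. f ^ \<alpha> f) * (\<Prod>f\<in>F - T. f ^ b) \<in> fold_ideal" by simp
  have "sum (\<lambda>f. M f - \<alpha> f) T = sum M T - e" using \<alpha> by (simp add: sum_subtractf_nat)
  then have 2: "(\<Prod>f\<in>T. f ^ (M f - \<alpha> f)) * (\<Prod>f\<in>F - T. f ^ b) ^ m \<in> ideal_power R fold_ideal m"
    using Suc.prems by (intro Suc.IH) simp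
  have "(\<Prod>f\<in>T. f ^ M f) = (\<Prod>f\<in>T. f ^ (M f - \<alpha> f)) * (\<Prod>f\<in>T. f ^ \<alpha> f)"
    using \<alpha>(1) by (simp flip: prod.distrib power_add)
  then have eq: "(\<Prod>f\<in>T. f ^ M f) * (\<Prod>f\<in>F - T. f ^ b) ^ Suc m =
      ((\<Prod>f\<in>T. f ^ (M f - \<alpha> f)) * (\<Prod>f\<in>F - T. f ^ b) ^ m) * ((\<Prod>f\<in>T. f ^ \<alpha> f) * (\<Prod>f\<in>F - T. f ^ b))"
    by (simp add: ac_simps)
  show ?case unfolding eq ideal_power_Suc by (rule ideal_prod_memI[OF 2 1])
qed

text \<open>At a minimal prime exactly \<open>h\<close> forms are non-units, and the product of the
  others, raised to b m, is a multiplier outside the prime for which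
  \<open>prod_in_fold_power\<close> applies.\<close>

lemma prod_in_star_symbolic_power:
  assumes N: "\<And>T. T \<subseteq> F \<Longrightarrow> card T = h \<Longrightarrow> e * m \<le> sum N T"
  shows "(\<Prod>f\<in>F. f ^ N f) \<in> star_symbolic_power n fold_ideal m"
  unfolding star_symbolic_power_iff[OF is_ideal_fold]
proof (intro conjI allI impI)
  show "(\<Prod>f\<in>F. f ^ N f) \<in> carrier R" by (rule prod_F_mem) simp
  fix p assume p: "minimal_over fold_ideal p"
  then have pp: "is_prime p" by (simp add: minimal_over_def)
  let ?T = "F \<inter> p"
  let ?u = "(\<Prod>f\<in>F - ?T. f ^ b) ^ m"
  have uR: "(\<Prod>f\<in>F - ?T. f ^ b) \<in> carrier R" using F_mem by (intro prod_mem) auto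
  have "?u \<notin> p"
  proof
    assume "?u \<in> p"
    then have "(\<Prod>f\<in>F - ?T. f ^ b) \<in> p" using is_prime_power[OF pp uR] by blast
    then obtain f where "f \<in> F - ?T" "f ^ b \<in> p"
      using is_prime_prod[OF pp, of "F - ?T" "\<lambda>f. f ^ b"] finite_F F_mem by auto
    then show False using is_prime_power[OF pp, of f b] F_mem by auto
  qed
  then have u: "?u \<in> carrier R - p" using uR by simp
  have card: "card ?T = h" by (rule card_minimal_prime[OF p])
  have "e * m \<le> sum N ?T" using N card by simp
  then have mem: "(\<Prod>f\<in>?T. f ^ N f) * ?u \<in> ideal_power R fold_ideal m"
    using prod_in_fold_power[OF _ card] by simp
  have split: "F = ?T \<union> (F - ?T)" by blast
  have "(\<Prod>f\<in>F. f ^ N f) = (\<Prod>f\<in>?T. f ^ N f) * (\<Prod>f\<in>F - ?T. f ^ N f)"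
    by (subst split, rule prod.union_disjoint) (use finite_F in auto)
  then have "?u * (\<Prod>f\<in>F. f ^ N f) = (\<Prod>f\<in>F - ?T. f ^ N f) * ((\<Prod>f\<in>?T. f ^ N f) * ?u)"
    by (simp add: ac_simps)
  also have "\<dots> \<in> ideal_power R fold_ideal m"
    by (intro is_idealD(4)[OF is_ideal_ideal_power[OF is_ideal_fold] _ mem] prod_F_mem Diff_subset)
  finally show "\<exists>t\<in>carrier R - p. t * (\<Prod>f\<in>F. f ^ N f) \<in> ideal_power R fold_ideal m"
    using u by blast
qed

text \<open>An exponent may be lowered as long as it occurs in no \<open>h\<close>-subset of minimal total weight. If some
  exponent equals \<open>b m > e m\<close>, it occurs in no such subset; otherwise there is no such subset at all.\<close>

lemma fold_power_contained:
  assumes eb: "e < b" and m: "m > 0"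
  shows "ideal_power R fold_ideal m \<subseteq> ideal_prod R (genideal R F) (star_symbolic_power n fold_ideal m)"
proof (rule fold_power_least)
  show "is_ideal (ideal_prod R (genideal R F) (star_symbolic_power n fold_ideal m))"
    by (intro is_ideal_ideal_prod is_ideal_genideal F_subset is_ideal_star_symbolic_power is_ideal_fold)
  fix N assume N: "\<forall>f\<in>F. N f \<le> b * m" "(\<Sum>f\<in>F. N f) = a * m"
  \<comment> \<open>The \<open>c\<close> forms outside \<open>T\<close> absorb at most c b m of the
    total a m = (b c + e) m, which leaves at least e m on \<open>T\<close>, and more if every
    exponent stays below b m.\<close>
  have sums: "e * m \<le> sum N T \<and> ((\<forall>f\<in>F. N f < b * m) \<longrightarrow> e * m < sum N T)"
    if T: "T \<subseteq> F" "card T = h" for T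
  proof -
    have fT: "finite T" using T(1) finite_F finite_subset by blast
    have card_co: "card (F - T) = c" using T card_F fT by (simp add: card_Diff_subset)
    have split: "F = T \<union> (F - T)" using T(1) by blast
    have "sum N F = sum N T + sum N (F - T)"
      by (subst split, rule sum.union_disjoint) (use fT finite_F in auto)
    then have tot: "b * c * m + e * m = sum N T + sum N (F - T)"
      using N(2) by (simp add: a distrib_right)
    have "sum N (F - T) \<le> c * (b * m)"
      using N(1) sum_bounded_above[of "F - T" N "b * m"] card_co by simp
    moreover have "sum N (F - T) < c * (b * m)" if "\<forall>f\<in>F. N f < b * m"
    proof -
      \<comment> \<open>Strictness needs \<open>c\<close> to be positive, which follows from h \<le>
        n < h + c.\<close>
      have "card (F - T) > 0" using card_co h by simp
      then have "F - T \<noteq> {}" by (metis card.empty less_irrefl)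
      then have "sum N (F - T) < (\<Sum>f\<in>F - T. b * m)"
        using that finite_F by (intro sum_strict_mono) auto
      then show ?thesis using card_co by simp
    qed
    moreover have "b * c * m = c * (b * m)" by simp
    ultimately show ?thesis using tot by linarith
  qed
  obtain g where g: "g \<in> F" "N g > 0" "\<And>T. T \<subseteq> F \<Longrightarrow> card T = h \<Longrightarrow> g \<in> T \<Longrightarrow> e * m < sum N T"
  proof (cases "\<exists>g\<in>F. N g = b * m")
    case True
    then obtain g where g: "g \<in> F" "N g = b * m" by blast
    have em: "e * m < b * m" using eb m by simp
    show thesis
    proof (rule that[OF g(1)])
      show "N g > 0" using g(2) em by simp
      fix T assume "T \<subseteq> F" "g \<in> T"
      then have "N g \<le> sum N T" using finite_F finite_subset by (intro member_le_sum) auto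
      with g(2) em show "e * m < sum N T" by linarith
    qed
  next
    case False
    then have less: "\<forall>f\<in>F. N f < b * m" using N(1) by (metis le_neq_implies_less)
    have "\<exists>g\<in>F. N g > 0"
    proof (rule ccontr)
      assume "\<not> ?thesis"
      then have "sum N F = 0" by simp
      then show False using N(2) a e m by simp
    qed
    then show thesis using that less sums by blast
  qed
  \<comment> \<open>Removing one factor \<open>g\<close> costs weight only on subsets containing
    \<open>g\<close>, and these had weight to spare.\<close>
  define N' where "N' = N(g := N g - 1)"
  have "e * m \<le> sum N' T" if T: "T \<subseteq> F" "card T = h" for T
  proof (cases "g \<in> T")
    case True
    have fT: "finite T" using T(1) finite_F finite_subset by blast
    have "sum N' (T - {g}) = sum N (T - {g})" unfolding N'_def by (intro sum.cong) auto
    then have "Suc (sum N' T) = sum N T"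
      using True fT g(2) by (simp add: sum.remove N'_def)
    then show ?thesis using g(3)[OF T True] by simp
  next
    case False
    then have "sum N' T = sum N T" unfolding N'_def by (intro sum.cong) auto
    then show ?thesis using sums[OF T] by simp
  qed
  then have "(\<Prod>f\<in>F. f ^ N' f) \<in> star_symbolic_power n fold_ideal m"
    by (rule prod_in_star_symbolic_power)
  moreover have "g \<in> genideal R F" using genideal_superset[OF F_subset] g(1) by blast
  ultimately have "g * (\<Prod>f\<in>F. f ^ N' f) \<in> ideal_prod R (genideal R F) (star_symbolic_power n fold_ideal m)"
    by (intro ideal_prod_memI)
  moreover have "g * (\<Prod>f\<in>F. f ^ N' f) = (\<Prod>f\<in>F. f ^ N f)"
  proof -
    have "(\<Prod>f\<in>F - {g}. f ^ N' f) = (\<Prod>f\<in>F - {g}. f ^ N f)"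
      unfolding N'_def by (intro prod.cong) auto
    moreover have "g * g ^ N' g = g ^ N g" using g(2) by (simp add: N'_def flip: power_Suc)
    ultimately show ?thesis using g(1) finite_F by (simp add: prod.remove flip: mult.assoc)
  qed
  ultimately show "(\<Prod>f\<in>F. f ^ N f) \<in> ideal_prod R (genideal R F) (star_symbolic_power n fold_ideal m)"
    by simp
qed

text \<open>The witness is \<open>g\<close>, the product of all f^(b m) with f in \<open>U\<close>.
  Modulo the ideal of \<open>W\<close> the symbolic power consists of multiples of \<open>g\<close>,
  so multiplying it by forms of positive degree can no longer reach \<open>g\<close> itself.\<close>

lemma fold_power_not_contained:
  assumes eb: "e = b" and m: "m > 0"
  shows "\<not> ideal_power R fold_ideal m \<subseteq> ideal_prod R (genideal R F) (star_symbolic_power n fold_ideal m)"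
proof
  assume contained: "ideal_power R fold_ideal m \<subseteq> ideal_prod R (genideal R F) (star_symbolic_power n fold_ideal m)"
  \<comment> \<open>With h - 1 forms in \<open>W\<close>, adding any single form gives the
    \<open>h\<close> forms of a minimal prime, and the c + 1 forms left over satisfy b (c+1) =
    a.\<close>
  have "h - 1 \<le> card F" using card_F by simp
  then obtain W where W: "W \<subseteq> F" "card W = h - 1" "finite W" by (rule obtain_subset_with_card_n)
  define U where "U = F - W"
  have cardU: "card U = c + 1" using W card_F h by (simp add: U_def card_Diff_subset)
  have finU: "finite U" using finite_F by (simp add: U_def)
  have UF: "j \<in> F" "j \<in> carrier R" "j \<notin> W" if "j \<in> U" for j using that F_mem by (auto simp: U_def)
  obtain ws where ws: "set ws = W" "distinct ws" using finite_distinct_list[OF W(3)] by blast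
  have len: "length ws = h - 1" using ws W(2) distinct_card by metis
  have wsR: "set ws \<subseteq> carrier R" using ws W F_subset by blast
  define J where "J = adjoin_list {0} ws"
  have J: "is_ideal J" unfolding J_def by (intro is_ideal_adjoin_list is_ideal_zero wsR)
  have WJ: "W \<subseteq> J" using adjoin_list_mem[OF is_ideal_zero wsR] ws by (auto simp: J_def)
  \<comment> \<open>\<open>Q j k\<close> is (W, j^k); these ideals multiply like the powers of
    \<open>j\<close> modulo \<open>W\<close>.\<close>
  define Q where "Q j k = adjoin J (j ^ k)" for j k
  have Q: "is_ideal (Q j k)" if "j \<in> U" for j k
    unfolding Q_def using J UF[OF that] by (intro is_ideal_adjoin) auto
  have Q_mult: "x * y \<in> Q j (k + l)" if j: "j \<in> U" and xy: "x \<in> Q j k" "y \<in> Q j l" for j x y k l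
  proof -
    obtain w r where x: "x = w + j ^ k * r" "w \<in> J" "r \<in> carrier R" using xy by (auto simp: Q_def adjoin_def)
    obtain w' r' where y: "y = w' + j ^ l * r'" "w' \<in> J" "r' \<in> carrier R" using xy by (auto simp: Q_def adjoin_def)
    have yR: "y \<in> carrier R" using is_idealD(6)[OF Q[OF j] xy(2)] .
    have "x * y = w * y + (j ^ k * r) * y" by (simp add: x(1) distrib_right)
    also have "(j ^ k * r) * y = (j ^ k * r) * w' + j ^ (k + l) * (r * r')"
      by (simp add: y(1) algebra_simps power_add)
    finally have "x * y = (w * y + (j ^ k * r) * w') + j ^ (k + l) * (r * r')" by (simp add: add.assoc)
    moreover have "w * y + (j ^ k * r) * w' \<in> J"
      using x y yR UF[OF j] is_idealD(4)[OF J, of "j ^ k * r" w'] is_idealD(5)[OF J, of y w]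
      by (intro is_idealD(3)[OF J]) auto
    ultimately show ?thesis using x y unfolding Q_def by (simp add: adjoin_memI)
  qed
  \<comment> \<open>A generator that avoids \<open>W\<close> distributes weight a = b (c+1) over the
    c + 1 forms of \<open>U\<close>, so each of them, \<open>j\<close> included, has the full
    exponent \<open>b\<close>.\<close>
  have fold_Q: "fold_ideal \<subseteq> Q j b" if j: "j \<in> U" for j
  proof (rule fold_least[OF Q[OF j]])
    fix N assume N: "\<forall>f\<in>F. N f \<le> b" "(\<Sum>f\<in>F. N f) = a"
    show "(\<Prod>f\<in>F. f ^ N f) \<in> Q j b"
    proof (cases "\<exists>f\<in>W. N f > 0")
      case True
      then obtain f where f: "f \<in> W" "N f \<ge> 1" by auto
      then have "f ^ 1 \<in> Q j b" "f \<in> F" using WJ adjoin_superset W(1) by (auto simp: Q_def)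
      then show ?thesis using prod_mem_ideal[OF Q[OF j]] f(2) by blast
    next
      case False
      then have sumU: "sum N U = a" using N(2) sum.mono_neutral_right[of F U N] finite_F by (auto simp: U_def)
      have "N j \<ge> b"
      proof (rule ccontr)
        assume "\<not> ?thesis"
        then have "sum N U < (\<Sum>f\<in>U. b)"
          using N(1) UF j finU by (intro sum_strict_mono_ex1) (auto intro: bexI[of _ j])
        then show False using sumU cardU a eb by (simp add: mult.commute)
      qed
      moreover have "j ^ b \<in> Q j b" unfolding Q_def by (intro adjoin_mem is_idealD(2)[OF J])
      ultimately show ?thesis using prod_mem_ideal[OF Q[OF j] UF(1)[OF j]] by blast
    qed
  qed
  have power_Q: "ideal_power R fold_ideal k \<subseteq> Q j (b * k)" if j: "j \<in> U" for j k
  proof (induction k)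
    case 0
    have "0 + j ^ 0 * r \<in> Q j (b * 0)" if "r \<in> carrier R" for r
      unfolding Q_def mult_0_right using that is_idealD(2)[OF J] by (intro adjoin_memI)
    then show ?case unfolding ideal_power_0 by auto
  next
    case (Suc k)
    show ?case
      unfolding ideal_power_Suc
    proof (rule ideal_prod_least[OF Q[OF j]])
      fix x y assume "x \<in> ideal_power R fold_ideal k" "y \<in> fold_ideal"
      then have "x * y \<in> Q j (b * k + b)" using Suc fold_Q[OF j] by (intro Q_mult[OF j]) auto
      then show "x * y \<in> Q j (b * Suc k)" by (simp add: add.commute)
    qed
  qed
  define M where "M = b * m"
  have M: "M > 0" using e m by (simp add: M_def)
  have star_Q: "r \<in> Q j M" if j: "j \<in> U" and r: "r \<in> star_symbolic_power n fold_ideal m" for j r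
  proof -
    \<comment> \<open>Since \<open>F\<close> has at least n + 1 elements, \<open>W\<close> and
      \<open>j\<close> extend to n + 1 forms, the length that \<open>unmixed\<close>
      requires.\<close>
    have "card (insert j W) = h" using UF[OF j] W h by simp
    then have "n + 1 - h \<le> card (F - insert j W)"
      using card_F h UF[OF j] W(1,3) by (subst card_Diff_subset) auto
    then obtain Y where Y: "Y \<subseteq> F - insert j W" "card Y = n + 1 - h" "finite Y"
      by (rule obtain_subset_with_card_n)
    obtain ys where ys: "set ys = Y" "distinct ys" using finite_distinct_list[OF Y(3)] by blast
    have leny: "length ys = n + 1 - h" using ys Y(2) distinct_card by metis
    have rR: "r \<in> carrier R" using r by (simp add: star_symbolic_power_def)
    have dist: "distinct (ws @ j # ys)" using ws ys Y(1) UF[OF j] by auto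
    have subF: "set (ws @ j # ys) \<subseteq> F" using ws ys Y(1) UF[OF j] W(1) by auto
    have length: "length (ws @ j # ys) = n + 1" using len leny h by simp
    have Qeq: "adjoin_list {0} (ws @ [j ^ M]) = Q j M" by (simp add: Q_def J_def)
    have "r \<in> adjoin_list {0} (ws @ [j ^ M])"
    proof (rule unmixed[OF _ _ length M rR])
      show "\<forall>x\<in>set (ws @ j # ys). is_form x" using subF is_form_F by blast
      show "regseq {0} (ws @ j # ys)" using dist subF length by (intro regseq_F) auto
      fix p assume p: "minimal_over (adjoin_list {0} (ws @ [j])) p"
      \<comment> \<open>Thus the symbolic power supplies a multiplier at every minimal prime of (W,
        j), and the product it yields lies in the ordinary power, hence in \<open>Q j M\<close> by
        \<open>power_Q\<close>.\<close>
      have "minimal_over fold_ideal p"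
        using dist subF len h p by (intro minimal_over_fold_ideal[of "ws @ [j]"]) auto
      then obtain t where "t \<in> carrier R - p" "t * r \<in> ideal_power R fold_ideal m"
        using r unfolding star_symbolic_power_iff[OF is_ideal_fold] by blast
      then show "\<exists>t\<in>carrier R - p. t * r \<in> adjoin_list {0} (ws @ [j ^ M])"
        using power_Q[OF j, of m] unfolding Qeq M_def[symmetric] by blast
    qed
    then show ?thesis by (simp only: Qeq)
  qed
  have nz1: "nonzerodiv J j" if j: "j \<in> U" for j
  proof -
    have "regseq {0} (ws @ [j])" using ws W UF[OF j] len h by (intro regseq_F) auto
    then show ?thesis by (simp add: regseq_append J_def)
  qed
  have nz2: "nonzerodiv (Q k M) j" if jk: "j \<in> U" "k \<in> U" "j \<noteq> k" for j k
  proof -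
    have "regseq {0} (ws @ k # [j])" using ws W UF jk len h by (intro regseq_F) auto
    moreover have "\<forall>x\<in>set (ws @ k # [j]). is_form x" using ws W UF jk is_form_F by auto
    ultimately have "regseq {0} (ws @ k ^ M # [j])" using regseq_power[OF hom_ideal_zero] M by blast
    then show ?thesis by (simp add: regseq_append J_def Q_def)
  qed
  \<comment> \<open>The ideals (W, j^M) intersect in the ideal generated by \<open>W\<close> and the
    product of the j^M. For a new form \<open>k\<close>, write r = w + ?g r1; the old product ?g is
    a nonzerodivisor modulo (W, k^M), so r1 itself lies in (W, k^M).\<close>
  have inter: "r \<in> adjoin J (\<Prod>j\<in>V. j ^ M)"
    if "finite V" "V \<subseteq> U" "r \<in> carrier R" "\<And>j. j \<in> V \<Longrightarrow> r \<in> Q j M" for r V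
    using that
  proof (induction V)
    case empty
    then show ?case using adjoin_memI[of 0 J r 1] is_idealD(2)[OF J] by simp
  next
    case (insert k V)
    let ?g = "\<Prod>j\<in>V. j ^ M"
    have k: "k \<in> U" using insert.prems by simp
    have "r \<in> adjoin J ?g" using insert by auto
    then obtain w r1 where 1: "r = w + ?g * r1" "w \<in> J" "r1 \<in> carrier R" by (auto simp: adjoin_def)
    have "w \<in> Q k M" using 1(2) adjoin_superset by (auto simp: Q_def)
    moreover have "w + ?g * r1 \<in> Q k M" using insert.prems(3)[of k] 1(1) by simp
    ultimately have "?g * r1 \<in> Q k M" using is_ideal_cancel_left[OF Q[OF k]] by blast
    moreover have "nonzerodiv (Q k M) ?g"
      using insert.hyps insert.prems(1) UF nz2[OF _ k]
      by (intro nonzerodiv_prod conjI nonzerodiv_power power_mem) blast+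
    ultimately have "r1 \<in> Q k M" using nonzerodivD 1(3) by blast
    then obtain w2 r2 where 2: "r1 = w2 + k ^ M * r2" "w2 \<in> J" "r2 \<in> carrier R" by (auto simp: Q_def adjoin_def)
    have gR: "?g \<in> carrier R" using insert.prems UF by (intro prod_mem power_mem) auto
    have "r = (w + ?g * w2) + (\<Prod>j\<in>insert k V. j ^ M) * r2"
      using insert.hyps 1 2 by (simp add: algebra_simps)
    moreover have "w + ?g * w2 \<in> J" using 1 2 gR is_idealD(3,4)[OF J] by simp
    ultimately show ?case using 2(3) by (simp only: adjoin_memI)
  qed
  define g where "g = (\<Prod>j\<in>U. j ^ M)"
  have gR: "g \<in> carrier R" unfolding g_def using UF by (intro prod_mem power_mem)
  have "nonzerodiv J g"
    unfolding g_def using UF nz1 by (intro nonzerodiv_prod conjI nonzerodiv_power power_mem)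
  have star_g: "star_symbolic_power n fold_ideal m \<subseteq> adjoin J g"
    unfolding g_def using star_Q by (auto intro!: inter[OF finU] simp: star_symbolic_power_def)
  \<comment> \<open>Multiplying an element w + g z of (W, g) by an element of the ideal of
    \<open>F\<close> makes the coefficient of \<open>g\<close> lose its constant term, so
    \<open>L\<close> contains the whole product ideal.\<close>
  define L where "L = {w + g * z | w z. w \<in> J \<and> z \<in> irrelevant_ideal}"
  note irr = is_ideal_irrelevant
  have LI: "w + g * z \<in> L" if "w \<in> J" "z \<in> irrelevant_ideal" for w z using that unfolding L_def by blast
  have L: "is_ideal L"
    unfolding is_ideal_def
  proof (intro conjI ballI)
    show "L \<subseteq> carrier R" using is_idealD(6)[OF J] is_idealD(6)[OF irr] gR by (auto simp: L_def)
    show "0 \<in> L" using LI[OF is_idealD(2)[OF J] is_idealD(2)[OF irr]] by simp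
  next
    fix x y assume "x \<in> L" "y \<in> L"
    then obtain w z w' z' where *: "x = w + g * z" "w \<in> J" "z \<in> irrelevant_ideal"
      "y = w' + g * z'" "w' \<in> J" "z' \<in> irrelevant_ideal" unfolding L_def by blast
    have "x + y = (w + w') + g * (z + z')" by (simp add: * algebra_simps)
    also have "\<dots> \<in> L" using * is_idealD(3)[OF J] is_idealD(3)[OF irr] by (intro LI) auto
    finally show "x + y \<in> L" .
  next
    fix r x assume r: "r \<in> carrier R" and "x \<in> L"
    then obtain w z where *: "x = w + g * z" "w \<in> J" "z \<in> irrelevant_ideal" unfolding L_def by blast
    have "r * x = r * w + g * (r * z)" by (simp add: * algebra_simps)
    also have "\<dots> \<in> L" using * r is_idealD(4)[OF J] is_idealD(4)[OF irr] by (intro LI) auto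
    finally show "r * x \<in> L" .
  qed
  have F_irr: "genideal R F \<subseteq> irrelevant_ideal"
    using is_form_F is_form_irrelevant by (intro genideal_least irr) auto
  have "ideal_prod R (genideal R F) (star_symbolic_power n fold_ideal m) \<subseteq> L"
  proof (rule ideal_prod_least[OF L])
    fix x y assume x: "x \<in> genideal R F" and "y \<in> star_symbolic_power n fold_ideal m"
    then obtain w z where *: "y = w + g * z" "w \<in> J" "z \<in> carrier R"
      using star_g by (auto simp: adjoin_def)
    have xi: "x \<in> irrelevant_ideal" "x \<in> carrier R" using x F_irr is_idealD(6)[OF irr] by auto
    have "x * y = x * w + g * (x * z)" by (simp add: * algebra_simps)
    also have "\<dots> \<in> L" using * xi is_idealD(4)[OF J] is_idealD(5)[OF irr] by (intro LI) auto
    finally show "x * y \<in> L" .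
  qed
  moreover have "g \<in> ideal_power R fold_ideal m"
  proof -
    \<comment> \<open>As e = b and \<open>U\<close> has c + 1 elements, the product of the f^b over
      \<open>U\<close> is a generator, and \<open>g\<close> is its m-th power.\<close>
    define N where "N f = (if f \<in> U then b else 0)" for f
    have UsubF: "U \<subseteq> F" by (auto simp: U_def)
    have "sum N F = sum N U"
      using finite_F UsubF by (intro sum.mono_neutral_right) (auto simp: N_def)
    also have "\<dots> = a" using cardU a eb by (simp add: N_def mult.commute)
    finally have mem: "(\<Prod>f\<in>F. f ^ N f) \<in> fold_ideal" by (intro fold_memI) (simp_all add: N_def)
    have "(\<Prod>f\<in>F. f ^ N f) = (\<Prod>f\<in>U. f ^ N f)"
      using finite_F UsubF by (intro prod.mono_neutral_right) (auto simp: N_def)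
    also have "\<dots> = (\<Prod>f\<in>U. f ^ b)" by (simp add: N_def)
    finally have "g = (\<Prod>f\<in>F. f ^ N f) ^ m"
      by (simp add: g_def M_def power_mult prod_power_distrib)
    then show ?thesis using power_in_ideal_power[OF mem] by simp
  qed
  ultimately obtain w z where wz: "g = w + g * z" "w \<in> J" "z \<in> irrelevant_ideal"
    using contained unfolding L_def by blast
  have zR: "z \<in> carrier R" using is_idealD(6)[OF irr wz(3)] .
  have "g * (1 - z) = w" using wz(1) by (simp add: algebra_simps)
  \<comment> \<open>Cancelling \<open>g\<close> modulo \<open>J\<close> leaves an element with
    constant term 1 in an ideal generated by forms of positive degree.\<close>
  then have "1 - z \<in> J" using nonzerodivD[OF \<open>nonzerodiv J g\<close>, of "1 - z"] wz(2) zR by simp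
  moreover have "J \<subseteq> irrelevant_ideal"
    unfolding J_def using ws W(1) is_form_F is_form_irrelevant is_idealD(2)[OF irr]
    by (intro adjoin_list_least irr) auto
  ultimately have "(1 - z) + z \<in> irrelevant_ideal" using is_idealD(3)[OF irr] wz(3) by blast
  then show False using one_not_irrelevant by simp
qed

end

theorem proposition5p6:
  fixes a b n s d :: nat
    and F :: "('k::field) mpol set"
  assumes "infinite (UNIV :: 'k set)"
    and "a > 0" and "b > 0" and "n > 0" and "s > 0"
    and "s \<ge> n + 1"
    and "b * (s - n) + 1 \<le> a" and "a \<le> s * b"
    and "finite F" and "card F = s"
    and "generic_set n F"
    and "d > 0" and "\<forall>f\<in>F. homogeneous d f"
  defines "R \<equiv> mpoly_ring n"
  defines "I \<equiv> fold_product_ideal n a b F"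
  defines "noncontained \<equiv> \<lambda>m::nat.
      \<not> ideal_power R I m \<subseteq> ideal_prod R (genideal R F) (star_symbolic_power n I m)"
  shows "((\<forall>m>0. noncontained m) \<longleftrightarrow> (\<exists>m>0. noncontained m)) \<and>
         ((\<exists>m>0. noncontained m) \<longleftrightarrow> b dvd a)"
proof -
  \<comment> \<open>Dividing a - 1 instead of \<open>a\<close> puts the remainder into 1..b, so
    multiples of \<open>b\<close> correspond to e = b.\<close>
  define c where "c = (a - 1) div b"
  define e where "e = (a - 1) mod b + 1"
  have a1: "a - 1 = b * c + (e - 1)" by (simp add: c_def e_def)
  have ae: "a = b * c + e" using a1 \<open>a > 0\<close> by (simp add: e_def)
  have e: "1 \<le> e" "e \<le> b" using mod_less_divisor[OF \<open>b > 0\<close>, of "a - 1"] by (simp_all add: e_def)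
  \<comment> \<open>The lower bound on \<open>a\<close> gives h \<le> n, and the upper bound gives h
    \<ge> 1.\<close>
  have "b * (s - n) div b \<le> c" unfolding c_def using assms(7) by (intro div_le_mono) simp
  then have c1: "s - n \<le> c" using \<open>b > 0\<close> by simp
  have c2: "c < s" unfolding c_def using assms(2,3,8) by (simp add: less_mult_imp_div_less)
  define h where "h = s - c"
  interpret generic_forms n "TYPE('k)" F a b c e h
    by unfold_locales (use assms(6,9-11) c1 c2 e ae in \<open>auto simp: h_def\<close>)
  have dvd: "b dvd a \<longleftrightarrow> e = b"
  proof
    assume "b dvd a"
    then have "b dvd e" unfolding ae by (simp add: dvd_add_right_iff)
    then show "e = b" using e by (simp add: dvd_imp_le order_antisym)
  qed (simp add: ae)
  \<comment> \<open>The criterion does not depend on \<open>m\<close>, so it makes no difference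
    whether it is asked for all positive \<open>m\<close> or for some.\<close>
  have "noncontained m \<longleftrightarrow> b dvd a" if "m > 0" for m
    unfolding noncontained_def R_def I_def dvd
    using fold_power_contained[OF _ that] fold_power_not_contained[OF _ that] e(2)
    by (metis order_le_less)
  then show ?thesis using zero_less_one by blast
qed

end
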